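(* Let $S$ be either a topological group or (the underlying semigroup of) a bi-amenable measured semigroup $(S,\lambda)$. If $E$ is a Banach space and $\pi$ is a relatively weakly compact representation of $S$ on $E$, then $\pi$ is JdLG-admissible. In particular, if $\mathscr{T}$ is a semigroup of bounded linear operators on $E$ with $\operatorname{cl}_\sigma(\mathscr{T})=\operatorname{cl}_\sigma(\pi(S))$, then $\mathscr{T}$ is JdLG-admissible.
   Context: Banach spaces are complex. $\mathcal{L}(E)$ is the space of bounded linear operators on $E$; for sets of operators, "weakly" refers to the weak operator topology of $\mathcal{L}(E)$, and $\operatorname{cl}_\sigma$ denotes closure in that topology. A semitopological semigroup is a semigroup with a Hausdorff topology for which multiplication is separately continuous. For $s\in S$ put $L_s(t)=st$, $R_s(t)=ts$. A measured semigroup $(S,\lambda)$ is a semitopological semigroup $S$ with a Borel measure $\lambda$. It is bi-amenable if for every $s\in S$ and every Borel set $N$, $\lambda(N)=0$ implies $\lambda(L_s^{-1}(N))=\lambda(R_s^{-1}(N))=0$, and there is a bi-invariant mean on $L^\infty(S,\lambda)$, i.e. a positive linear functional $m:L^\infty(S,\lambda)\to\mathbb{C}$ of norm $1$ with $m(f\circ L_s)=m(f)=m(f\circ R_s)$ for all $s\in S$, $f\in L^\infty(S,\lambda)$. A representation $\pi$ of $S$ on $E$ is a semigroup homomorphism $\pi:S\to\mathcal{L}(E)$, $s\mapsto\pi_s$, continuous for the weak operator topology (with $\pi_e=\mathrm{Id}$ if $S$ has an identity $e$). It is relatively weakly compact if $\pi(S)=\{\pi_s:s\in S\}$ is relatively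 compact in the weak operator topology. A semigroup $\mathscr{T}\subseteq\mathcal{L}(E)$ is JdLG-admissible if it is relatively weakly compact and $\mathscr{S}:=\operatorname{cl}_\sigma(\mathscr{T})$ contains a unique minimal idempotent (an idempotent is minimal if it lies in the smallest two-sided ideal $K(\mathscr{S})$ of $\mathscr{S}$). Equivalently, $\mathscr{S}$ is weakly compact and the sets $E_r=\{\xi\in E:\forall u\in\mathscr{S}\ \exists v\in\mathscr{S},\ vu\xi=\xi\}$ and $E_{\mathrm{aws}}=\{\xi\in E: u\xi=0\text{ for some }u\in\mathscr{S}\}$ are closed $\mathscr{S}$-invariant linear subspaces with $E=E_r\oplus E_{\mathrm{aws}}$. A representation $\pi$ is JdLG-admissible if $\pi(S)$ is. *)

theory Defs
  imports "HOL-Analysis.Analysis"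
begin

class complex_normed_vector = real_normed_vector +
  fixes scaleC :: "complex \<Rightarrow> 'a \<Rightarrow> 'a" (infixr "*\<^sub>C" 75)
  assumes scaleC_add_right: "c *\<^sub>C (x + y) = c *\<^sub>C x + c *\<^sub>C y"
    and scaleC_add_left: "(c + d) *\<^sub>C x = c *\<^sub>C x + d *\<^sub>C x"
    and scaleC_scaleC: "c *\<^sub>C d *\<^sub>C x = (c * d) *\<^sub>C x"
    and scaleC_one: "1 *\<^sub>C x = x"
    and scaleR_scaleC: "r *\<^sub>R x = complex_of_real r *\<^sub>C x"
    and norm_scaleC: "norm (c *\<^sub>C x) = cmod c * norm x"

class complex_banach = complex_normed_vector + complete_space

instantiation complex :: complex_banach
begin

definition scaleC_complex :: "complex \<Rightarrow> complex \<Rightarrow> complex"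
  where "scaleC_complex c x = c * x"

instance
  by standard (auto simp: scaleC_complex_def algebra_simps norm_mult scaleR_conv_of_real)

end

definition bounded_clinear :: "('a::complex_normed_vector \<Rightarrow> 'b::complex_normed_vector) \<Rightarrow> bool"
  where "bounded_clinear f \<longleftrightarrow> bounded_linear f \<and> (\<forall>c x. f (c *\<^sub>C x) = c *\<^sub>C f x)"

text \<open>The algebra of bounded operators is the set of functions satisfying
  \<^const>\<open>bounded_clinear\<close>, with product \<open>(\<circ>)\<close> and unit \<open>id\<close>. The following is the weak operator
  topology on that set, i.e. the initial topology for the maps \<open>T \<mapsto> \<phi> (T x)\<close>.\<close>

definition wot :: "('a::complex_banach \<Rightarrow> 'a) topology"
  where "wot = topology_generated_by
    {{T. bounded_clinear T \<and> \<phi> (T x) \<in> U} | (\<phi> :: 'a \<Rightarrow> complex) x U. bounded_clinear \<phi> \<and> open U}"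

lemma topspace_wot: "topspace wot = {T :: 'a::complex_banach \<Rightarrow> 'a. bounded_clinear T}"
proof
  show "topspace wot \<subseteq> {T :: 'a \<Rightarrow> 'a. bounded_clinear T}"
    unfolding wot_def topology_generated_by_topspace by blast
  have *: "bounded_clinear (\<lambda>x::'a. 0::complex)"
    by (simp add: bounded_clinear_def scaleC_complex_def)
  have "{T :: 'a \<Rightarrow> 'a. bounded_clinear T} = {T. bounded_clinear T \<and> (\<lambda>x::'a. 0::complex) (T 0) \<in> UNIV}"
    by simp
  with * have "{T :: 'a \<Rightarrow> 'a. bounded_clinear T} \<in>
      {{T. bounded_clinear T \<and> \<phi> (T x) \<in> U} | (\<phi> :: 'a \<Rightarrow> complex) x U. bounded_clinear \<phi> \<and> open U}"
    using open_UNIV by blast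
  then show "{T :: 'a \<Rightarrow> 'a. bounded_clinear T} \<subseteq> topspace wot"
    unfolding wot_def topology_generated_by_topspace by (rule Union_upper)
qed

definition operator_semigroup :: "('a::complex_banach \<Rightarrow> 'a) set \<Rightarrow> bool"
  where "operator_semigroup \<T> \<longleftrightarrow>
    (\<forall>u\<in>\<T>. bounded_clinear u) \<and> (\<forall>u\<in>\<T>. \<forall>v\<in>\<T>. u \<circ> v \<in> \<T>)"

definition relatively_weakly_compact :: "('a::complex_banach \<Rightarrow> 'a) set \<Rightarrow> bool"
  where "relatively_weakly_compact \<T> \<longleftrightarrow> compactin wot (wot closure_of \<T>)"

definition two_sided_ideal :: "('a \<Rightarrow> 'a) set \<Rightarrow> ('a \<Rightarrow> 'a) set \<Rightarrow> bool"
  where "two_sided_ideal I \<S> \<longleftrightarrow>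
    I \<noteq> {} \<and> I \<subseteq> \<S> \<and> (\<forall>u\<in>\<S>. \<forall>v\<in>I. u \<circ> v \<in> I \<and> v \<circ> u \<in> I)"

definition smallest_ideal :: "('a \<Rightarrow> 'a) set \<Rightarrow> ('a \<Rightarrow> 'a) set \<Rightarrow> bool"
  where "smallest_ideal K \<S> \<longleftrightarrow>
    two_sided_ideal K \<S> \<and> (\<forall>I. two_sided_ideal I \<S> \<longrightarrow> K \<subseteq> I)"

definition minimal_idempotent :: "('a \<Rightarrow> 'a) set \<Rightarrow> ('a \<Rightarrow> 'a) \<Rightarrow> bool"
  where "minimal_idempotent \<S> p \<longleftrightarrow>
    p \<in> \<S> \<and> p \<circ> p = p \<and> (\<exists>K. smallest_ideal K \<S> \<and> p \<in> K)"

definition JdLG_admissible :: "('a::complex_banach \<Rightarrow> 'a) set \<Rightarrow> bool"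
  where "JdLG_admissible \<T> \<longleftrightarrow>
    operator_semigroup \<T> \<and> relatively_weakly_compact \<T> \<and>
    (\<exists>!p. minimal_idempotent (wot closure_of \<T>) p)"

text \<open>No separation axiom is required of a topological group here.\<close>

definition topological_group :: "'s::{semigroup_mult,topological_space} itself \<Rightarrow> bool"
  where "topological_group _ \<longleftrightarrow>
    (\<exists>(e::'s) i. group (*) e i \<and> continuous_on UNIV i) \<and>
    continuous_on UNIV (\<lambda>(s::'s, t). s * t)"

definition semitopological_semigroup :: "'s::{semigroup_mult,topological_space} itself \<Rightarrow> bool"
  where "semitopological_semigroup _ \<longleftrightarrow>
    Hausdorff_space (euclidean :: 's topology) \<and>
    (\<forall>s::'s. continuous_on UNIV (\<lambda>t. s * t) \<and> continuous_on UNIV (\<lambda>t. t * s))"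

definition measured_semigroup :: "'s::{semigroup_mult,topological_space} measure \<Rightarrow> bool"
  where "measured_semigroup \<mu> \<longleftrightarrow>
    semitopological_semigroup TYPE('s) \<and> sets \<mu> = sets borel"

definition Linf :: "'s measure \<Rightarrow> ('s \<Rightarrow> complex) set"
  where "Linf \<mu> = {f \<in> borel_measurable \<mu>. \<exists>C. AE x in \<mu>. cmod (f x) \<le> C}"

definition Linf_norm :: "'s measure \<Rightarrow> ('s \<Rightarrow> complex) \<Rightarrow> real"
  where "Linf_norm \<mu> f = Inf {C. 0 \<le> C \<and> (AE x in \<mu>. cmod (f x) \<le> C)}"

text \<open>Elements of \<^const>\<open>Linf\<close> are functions rather than classes of functions modulo
  almost-everywhere equality, so a functional has to be compatible with that relation. Its values
  outside \<^const>\<open>Linf\<close> are irrelevant. The condition on the boundedness of the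
  image of the unit ball makes the real-valued supremum meaningful.\<close>

definition mean :: "'s measure \<Rightarrow> (('s \<Rightarrow> complex) \<Rightarrow> complex) \<Rightarrow> bool"
  where "mean \<mu> m \<longleftrightarrow>
    (\<forall>f\<in>Linf \<mu>. \<forall>g\<in>Linf \<mu>. (AE x in \<mu>. f x = g x) \<longrightarrow> m f = m g) \<and>
    (\<forall>f\<in>Linf \<mu>. \<forall>g\<in>Linf \<mu>. m (\<lambda>x. f x + g x) = m f + m g) \<and>
    (\<forall>f\<in>Linf \<mu>. \<forall>c. m (\<lambda>x. c * f x) = c * m f) \<and>
    (\<forall>f\<in>Linf \<mu>. (AE x in \<mu>. f x \<in> \<real>\<^sub>\<ge>\<^sub>0) \<longrightarrow> m f \<in> \<real>\<^sub>\<ge>\<^sub>0) \<and>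
    bdd_above ((\<lambda>f. cmod (m f)) ` {f \<in> Linf \<mu>. Linf_norm \<mu> f \<le> 1}) \<and>
    (SUP f \<in> {f \<in> Linf \<mu>. Linf_norm \<mu> f \<le> 1}. cmod (m f)) = 1"

definition bi_invariant ::
    "'s::semigroup_mult measure \<Rightarrow> (('s \<Rightarrow> complex) \<Rightarrow> complex) \<Rightarrow> bool"
  where "bi_invariant \<mu> m \<longleftrightarrow>
    (\<forall>s. \<forall>f\<in>Linf \<mu>. m (\<lambda>t. f (s * t)) = m f \<and> m (\<lambda>t. f (t * s)) = m f)"

definition bi_amenable :: "'s::{semigroup_mult,topological_space} measure \<Rightarrow> bool"
  where "bi_amenable \<mu> \<longleftrightarrow> measured_semigroup \<mu> \<and>
    (\<forall>s. \<forall>N\<in>sets borel. emeasure \<mu> N = 0 \<longrightarrow>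
      emeasure \<mu> ((\<lambda>t. s * t) -` N) = 0 \<and> emeasure \<mu> ((\<lambda>t. t * s) -` N) = 0) \<and>
    (\<exists>m. mean \<mu> m \<and> bi_invariant \<mu> m)"

text \<open>The continuity clause includes that every \<open>\<pi> s\<close> lies in the topological space
  \<^const>\<open>wot\<close>, i.e. is a bounded complex-linear operator.\<close>

definition semigroup_rep ::
    "('s::{semigroup_mult,topological_space} \<Rightarrow> 'a::complex_banach \<Rightarrow> 'a) \<Rightarrow> bool"
  where "semigroup_rep \<pi> \<longleftrightarrow>
    (\<forall>s t. \<pi> (s * t) = \<pi> s \<circ> \<pi> t) \<and>
    continuous_map euclidean wot \<pi> \<and>
    (\<forall>e. (\<forall>s. e * s = s \<and> s * e = s) \<longrightarrow> \<pi> e = id)"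

end

theory Submission
  imports Defs
begin

text \<open>Let \<open>S\<close> be the weak operator closure of the image. It is a compact Hausdorff semitopological
  semigroup; the Hausdorff property is the only place where the Hahn-Banach theorem enters. Minimal
  idempotents exist by Ellis' lemma, and they are unique as soon as two minimal idempotents
  generating the same left ideal coincide, and likewise for right ideals. Passing to the opposite
  semigroup, only the first half has to be proved.

  For a dense group \<open>G\<close>, suppose \<open>p q = p\<close>, \<open>q p = q\<close> and \<open>f p \<noteq> f q\<close> with \<open>f\<close> continuous. Near every
  \<open>g p\<close> lie points \<open>g h p\<close> and \<open>g h q\<close> with \<open>h\<close> in \<open>G\<close> close to \<open>p\<close>, and \<open>y = (g h)\<^sup>-\<^sup>1\<close> separates them
  uniformly: \<open>f (y g h p) = f p\<close>, \<open>f (y g h q) = f q\<close>. Iterating this, with finite nets controlling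
  the functions met so far, produces sequences that violate Grothendieck's double limit criterion.

  An invariant mean induces a positive functional on \<open>C(S)\<close> invariant under translation by the dense
  image. Every translate \<open>f (u _)\<close> is a pointwise limit of a sequence of translates by elements of the
  image, so the functional is invariant under all of \<open>S\<close>. If the right ideals \<open>p S\<close> and \<open>r S\<close> were
  different, they would be disjoint, and a Urysohn function separating them would have mean both
  \<open>0\<close> and \<open>1\<close>.\<close>

section \<open>Compact spaces\<close>

text \<open>The closures of the tails are nested nonempty closed sets, so they have a common point
  by compactness. \<open>X\<close> need not be sequentially compact; \<open>z\<close> replaces the
  limit of a subsequence, since closed conditions that hold eventually along \<open>x\<close> also
  hold at \<open>z\<close>.\<close>

lemma compact_space_sequence_cluster:
  assumes "compact_space X" and x: "\<And>n. x n \<in> topspace X"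
  obtains z where "z \<in> topspace X"
    "\<And>C. closedin X C \<Longrightarrow> \<forall>\<^sub>F n in sequentially. x n \<in> C \<Longrightarrow> z \<in> C"
proof -
  define C where "C n = X closure_of (x ` {n..})" for n :: nat
  have "(\<Inter>n. C n) \<noteq> {}"
  proof (rule compact_space_imp_nest[OF assms(1)])
    show "closedin X (C n)" for n
      by (simp add: C_def)
    show "C n \<noteq> {}" for n
      using closure_of_subset[of "x ` {n..}" X] x by (auto simp: C_def)
    show "decseq C"
      by (auto simp: C_def decseq_def intro!: closure_of_mono)
  qed
  then obtain z where z: "\<And>n. z \<in> C n" by auto
  show thesis
  proof
    show "z \<in> topspace X"
      using z[of 0] closure_of_subset_topspace[of X "x ` {0..}"] unfolding C_def by blast
    fix D assume D: "closedin X D" "\<forall>\<^sub>F n in sequentially. x n \<in> D"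
    then obtain N where "x ` {N..} \<subseteq> D"
      by (auto simp: eventually_sequentially)
    then have "C N \<subseteq> D"
      unfolding C_def using D(1) by (rule closure_of_minimal)
    with z show "z \<in> D" by blast
  qed
qed

text \<open>Zorn's lemma is run on complements, so that a maximal complement gives a minimal set. A
  chain has nonempty intersection by the finite intersection property. The applications are to
  closed subsemigroups and to closed left ideals.\<close>

lemma compact_space_minimal_closed:
  assumes "compact_space X" and "P A"
    and closed: "\<And>A. P A \<Longrightarrow> closedin X A \<and> A \<noteq> {}"
    and Inter: "\<And>\<C>. \<C> \<noteq> {} \<Longrightarrow> (\<And>A. A \<in> \<C> \<Longrightarrow> P A) \<Longrightarrow> \<Inter>\<C> \<noteq> {} \<Longrightarrow> P (\<Inter>\<C>)"
  obtains M where "P M" "\<And>B. P B \<Longrightarrow> B \<subseteq> M \<Longrightarrow> B = M"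
proof -
  have sub: "A \<subseteq> topspace X" if "P A" for A
    using closed[OF that] closedin_subset by blast
  have "\<exists>M\<in>{topspace X - A |A. P A}. \<forall>B\<in>{topspace X - A |A. P A}. M \<subseteq> B \<longrightarrow> B = M"
  proof (rule subset_Zorn_nonempty)
    show "{topspace X - A |A. P A} \<noteq> {}"
      using \<open>P A\<close> by blast
    fix \<D> assume ne: "\<D> \<noteq> {}" and chain: "subset.chain {topspace X - A |A. P A} \<D>"
    then have sub\<D>: "\<exists>A. P A \<and> D = topspace X - A" if "D \<in> \<D>" for D
      using that unfolding subset_chain_def by blast
    define \<C> where "\<C> = {C. P C \<and> topspace X - C \<in> \<D>}"
    have P: "P C \<and> C \<subseteq> topspace X" if "C \<in> \<C>" for C
      using that sub by (simp add: \<C>_def)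
    have "\<C> \<noteq> {}"
      using ne sub\<D> unfolding \<C>_def by (metis (mono_tags, lifting) all_not_in_conv mem_Collect_eq)
    have "\<Inter>\<C> \<noteq> {}"
    proof -
      \<comment> \<open>A nonempty finite subfamily of a chain has a smallest member, which is its
        intersection.\<close>
      have *: "\<Inter>\<F> \<in> \<F>" if "finite \<F>" "\<F> \<noteq> {}" "\<F> \<subseteq> \<C>" for \<F>
        using that
      proof (induction \<F> rule: finite_ne_induct)
        case (insert C \<F>)
        have lin: "D \<subseteq> E \<or> E \<subseteq> D" if "D \<in> \<C>" "E \<in> \<C>" for D E
        proof -
          have "topspace X - D \<subseteq> topspace X - E \<or> topspace X - E \<subseteq> topspace X - D"
            using chain that unfolding subset_chain_def by (simp add: \<C>_def)
          then show ?thesis using P[OF that(1)] P[OF that(2)] by blast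
        qed
        have "\<Inter>\<F> \<in> \<C>" "C \<in> \<C>" using insert by auto
        from lin[OF this] insert show ?case by (auto simp: Int_absorb1 Int_absorb2)
      qed auto
      have ne: "\<Inter>\<F> \<noteq> {}" if "finite \<F>" "\<F> \<subseteq> \<C>" for \<F>
      proof (cases "\<F> = {}")
        case False
        from *[OF that(1) this that(2)] that(2) P closed show ?thesis by blast
      qed simp
      have "\<forall>C\<in>\<C>. closedin X C" using P closed by blast
      then show ?thesis
        using ne by (intro mp[OF spec[OF assms(1)[unfolded compact_space_fip], of \<C>]]) simp
    qed
    then have "P (\<Inter>\<C>)"
      by (intro Inter \<open>\<C> \<noteq> {}\<close> P[THEN conjunct1])
    moreover have "\<Union>\<D> = topspace X - \<Inter>\<C>"
    proof
      show "\<Union>\<D> \<subseteq> topspace X - \<Inter>\<C>"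
      proof
        fix x assume "x \<in> \<Union>\<D>"
        then obtain D where "D \<in> \<D>" "x \<in> D" by blast
        then obtain A where "P A" "D = topspace X - A" using sub\<D> by blast
        then show "x \<in> topspace X - \<Inter>\<C>"
          using \<open>D \<in> \<D>\<close> \<open>x \<in> D\<close> by (auto simp: \<C>_def)
      qed
    qed (auto simp: \<C>_def)
    ultimately show "\<Union>\<D> \<in> {topspace X - A |A. P A}" by blast
  qed
  then obtain M where M: "P M"
    "\<And>B. P B \<Longrightarrow> topspace X - M \<subseteq> topspace X - B \<Longrightarrow> topspace X - B = topspace X - M"
    by blast
  show thesis
  proof
    show "P M" by fact
    fix B assume "P B" "B \<subseteq> M"
    then show "B = M"
      using M(2)[OF \<open>P B\<close>] sub[OF \<open>P B\<close>] sub[OF M(1)] by blast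
  qed
qed

text \<open>This is total boundedness of the image of \<open>X\<close> under the finitely many
  functions in \<open>H\<close>: the sets \<open>N y\<close> are open and cover
  \<open>X\<close>.\<close>

lemma compact_space_finite_net:
  assumes "compact_space X" and fin: "finite H"
    and H: "\<And>h. h \<in> H \<Longrightarrow> continuous_map X euclideanreal h" and "\<delta> > 0"
  obtains Y where "finite Y" "Y \<subseteq> topspace X"
    "\<And>x. x \<in> topspace X \<Longrightarrow> \<exists>y\<in>Y. \<forall>h\<in>H. \<bar>h x - h y\<bar> < \<delta>"
proof -
  define N where "N y = {x \<in> topspace X. \<forall>h\<in>H. \<bar>h x - h y\<bar> < \<delta>}" for y
  have "openin X (N y)" for y
  \<comment> \<open>An empty intersection would be \<open>UNIV\<close> instead of
    \<open>topspace X\<close>.\<close>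
  proof (cases "H = {}")
    case False
    have "openin X {x \<in> topspace X. \<bar>h x - h y\<bar> \<in> {..<\<delta>}}" if "h \<in> H" for h
    proof (rule openin_continuous_map_preimage)
      show "continuous_map X euclideanreal (\<lambda>x. \<bar>h x - h y\<bar>)"
        using H[OF that] by (intro continuous_intros)
    qed simp
    then have "openin X (\<Inter>h\<in>H. {x \<in> topspace X. \<bar>h x - h y\<bar> \<in> {..<\<delta>}})"
      using fin False by (intro openin_Inter) auto
    also have "(\<Inter>h\<in>H. {x \<in> topspace X. \<bar>h x - h y\<bar> \<in> {..<\<delta>}}) = N y"
      using False by (auto simp: N_def)
    finally show ?thesis .
  qed (simp add: N_def)
  moreover have "topspace X \<subseteq> \<Union>(N ` topspace X)"
    using \<open>\<delta> > 0\<close> by (auto simp: N_def)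
  ultimately obtain \<F> where \<F>: "finite \<F>" "\<F> \<subseteq> N ` topspace X" "topspace X \<subseteq> \<Union>\<F>"
    using assms(1)[unfolded compact_space_alt, rule_format, of "N ` topspace X"] by blast
  then obtain Y where Y: "finite Y" "Y \<subseteq> topspace X" "\<F> = N ` Y"
    by (meson finite_subset_image)
  show thesis
    by (rule that[OF Y(1,2)]) (use \<F>(3) Y(3) in \<open>auto simp: N_def\<close>)
qed

lemma closedin_le_preimage:
  fixes f g :: "'b \<Rightarrow> real"
  assumes "continuous_map X euclideanreal f" "continuous_map X euclideanreal g"
  shows "closedin X {x \<in> topspace X. f x \<le> g x}"
proof -
  have "closedin X {x \<in> topspace X. f x - g x \<in> {..0}}"
    using continuous_map_diff[OF assms] by (rule closedin_continuous_map_preimage) simp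
  then show ?thesis by simp
qed

section \<open>Compact semitopological semigroups\<close>

text \<open>Composition is only separately continuous for the weak operator topology. The carrier is
  \<open>topspace X\<close>, because the semigroup of interest is a closure inside a function
  type.\<close>

locale compact_semitop_semigroup =
  fixes X :: "'b topology" and mul :: "'b \<Rightarrow> 'b \<Rightarrow> 'b" (infixl "\<star>" 70)
  assumes compact: "compact_space X" and Hausdorff: "Hausdorff_space X"
    and nonempty: "topspace X \<noteq> {}"
    and assoc: "\<lbrakk>a \<in> topspace X; b \<in> topspace X; c \<in> topspace X\<rbrakk> \<Longrightarrow> a \<star> b \<star> c = a \<star> (b \<star> c)"
    and continuous_left: "a \<in> topspace X \<Longrightarrow> continuous_map X X (\<lambda>x. a \<star> x)"
    and continuous_right: "a \<in> topspace X \<Longrightarrow> continuous_map X X (\<lambda>x. x \<star> a)"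
begin

lemma mul_closed [simp, intro]: "\<lbrakk>a \<in> topspace X; b \<in> topspace X\<rbrakk> \<Longrightarrow> a \<star> b \<in> topspace X"
  using continuous_map_image_subset_topspace[OF continuous_left[of a]] by (simp add: image_subset_iff)

text \<open>The axioms are symmetric; every later statement about right ideals is the left one read
  in the opposite semigroup.\<close>

lemma opposite: "compact_semitop_semigroup X (\<lambda>x y. y \<star> x)"
  unfolding compact_semitop_semigroup_def
  by (intro conjI allI impI compact Hausdorff nonempty continuous_left continuous_right assoc[symmetric])

lemma closedin_image:
  assumes "continuous_map X X f" "closedin X A"
  shows "closedin X (f ` A)"
  using image_compactin[OF closedin_compact_space[OF compact assms(2)] assms(1)]
    Hausdorff compactin_imp_closedin by blast

lemma normal: "normal_space X"
  using compact Hausdorff compact_Hausdorff_or_regular_imp_normal_space by blast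

lemma closedin_singleton: "x \<in> topspace X \<Longrightarrow> closedin X {x}"
  using Hausdorff by (rule closedin_Hausdorff_singleton)

text \<open>Ellis' lemma. Let \<open>M\<close> be a minimal closed subsemigroup and \<open>p\<close>
  in \<open>M\<close>. Minimality gives \<open>M p = M\<close>, so some \<open>y\<close> in
  \<open>M\<close> satisfies \<open>y p = p\<close>; the set of all such \<open>y\<close> is again a
  closed subsemigroup, hence equals \<open>M\<close> and contains \<open>p\<close>.\<close>

lemma idempotent_exists:
  assumes "closedin X C" "C \<noteq> {}" and C: "\<And>a b. a \<in> C \<Longrightarrow> b \<in> C \<Longrightarrow> a \<star> b \<in> C"
  obtains p where "p \<in> C" "p \<star> p = p"
proof -
  let ?P = "\<lambda>A. closedin X A \<and> A \<noteq> {} \<and> A \<subseteq> C \<and> (\<forall>a\<in>A. \<forall>b\<in>A. a \<star> b \<in> A)"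
  obtain M where M: "?P M" and min: "\<And>B. ?P B \<Longrightarrow> B \<subseteq> M \<Longrightarrow> B = M"
  proof (rule compact_space_minimal_closed[OF compact, of ?P C])
    show "?P C" using assms by blast
    show "?P (\<Inter>\<C>)" if "\<C> \<noteq> {}" "\<And>A. A \<in> \<C> \<Longrightarrow> ?P A" "\<Inter>\<C> \<noteq> {}" for \<C>
    proof (intro conjI)
      show "closedin X (\<Inter>\<C>)" using that by (intro closedin_Inter) auto
    qed (use that in blast)+
  qed blast+
  have MX: "M \<subseteq> topspace X" using M closedin_subset by blast
  obtain p where p: "p \<in> M" using M by blast
  then have pX: "p \<in> topspace X" using MX by blast
  have "(\<lambda>x. x \<star> p) ` M = M"
  proof (rule min)
    have "a \<star> p \<star> (b \<star> p) \<in> (\<lambda>x. x \<star> p) ` M" if "a \<in> M" "b \<in> M" for a b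
    proof
      have "a \<in> topspace X" "b \<in> topspace X" using that MX by auto
      then show "a \<star> p \<star> (b \<star> p) = a \<star> p \<star> b \<star> p"
        using pX assoc by simp
      show "a \<star> p \<star> b \<in> M" using that p M by blast
    qed
    then show "?P ((\<lambda>x. x \<star> p) ` M)"
      using M p closedin_image[OF continuous_right[OF pX], of M] by blast
  qed (use M p in blast)
  with p have "p \<in> (\<lambda>x. x \<star> p) ` M" by simp
  then obtain y where y: "y \<in> M" "y \<star> p = p" by auto
  have "{x \<in> M. x \<star> p = p} = M"
  proof (rule min)
    have cl: "closedin X (M \<inter> {x \<in> topspace X. x \<star> p \<in> {p}})"
      using M closedin_singleton[OF pX]
      by (intro closedin_Int closedin_continuous_map_preimage[OF continuous_right[OF pX]]) blast+
    have eq: "M \<inter> {x \<in> topspace X. x \<star> p \<in> {p}} = {x \<in> M. x \<star> p = p}"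
      using MX by blast
    have mul: "a \<star> b \<star> p = p" if "a \<in> M" "b \<in> M" "a \<star> p = p" "b \<star> p = p" for a b
      using that MX pX assoc[of a b p] by auto
    show "?P {x \<in> M. x \<star> p = p}"
    proof (intro conjI ballI)
      show "closedin X {x \<in> M. x \<star> p = p}" using cl eq by simp
      show "{x \<in> M. x \<star> p = p} \<noteq> {}" using y by blast
      show "{x \<in> M. x \<star> p = p} \<subseteq> C" using M by blast
      fix a b assume "a \<in> {x \<in> M. x \<star> p = p}" "b \<in> {x \<in> M. x \<star> p = p}"
      then show "a \<star> b \<in> {x \<in> M. x \<star> p = p}" using mul M by simp
    qed
  qed auto
  with p have "p \<in> {x \<in> M. x \<star> p = p}" by simp
  then have "p \<star> p = p" by simp
  moreover have "p \<in> C" using p M by blast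
  ultimately show thesis by (intro that)
qed

section \<open>Minimal left ideals and the least two-sided ideal\<close>

definition left_ideal :: "'b set \<Rightarrow> bool"
  where "left_ideal L \<longleftrightarrow> L \<noteq> {} \<and> L \<subseteq> topspace X \<and> (\<forall>a\<in>topspace X. \<forall>x\<in>L. a \<star> x \<in> L)"

definition minimal_left_ideal :: "'b set \<Rightarrow> bool"
  where "minimal_left_ideal L \<longleftrightarrow> left_ideal L \<and> (\<forall>L'. left_ideal L' \<longrightarrow> L' \<subseteq> L \<longrightarrow> L' = L)"

definition ideal :: "'b set \<Rightarrow> bool"
  where "ideal I \<longleftrightarrow>
    I \<noteq> {} \<and> I \<subseteq> topspace X \<and> (\<forall>a\<in>topspace X. \<forall>x\<in>I. a \<star> x \<in> I \<and> x \<star> a \<in> I)"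

definition least_ideal :: "'b set \<Rightarrow> bool"
  where "least_ideal K \<longleftrightarrow> ideal K \<and> (\<forall>I. ideal I \<longrightarrow> K \<subseteq> I)"

lemma left_ideal_principal:
  assumes "x \<in> topspace X"
  shows "left_ideal ((\<lambda>a. a \<star> x) ` topspace X)"
proof -
  have "b \<star> (a \<star> x) \<in> (\<lambda>a. a \<star> x) ` topspace X" if "a \<in> topspace X" "b \<in> topspace X" for a b
    using that assms assoc[of b a x] by (intro image_eqI[of _ _ "b \<star> a"]) auto
  then show ?thesis
    using assms nonempty by (auto simp: left_ideal_def)
qed

lemma minimal_left_idealD:
  assumes "minimal_left_ideal L" "x \<in> L"
  shows "(\<lambda>a. a \<star> x) ` topspace X = L"
proof -
  have "left_ideal L" and min: "\<And>L'. left_ideal L' \<Longrightarrow> L' \<subseteq> L \<Longrightarrow> L' = L"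
    using assms unfolding minimal_left_ideal_def by blast+
  then have "x \<in> topspace X" "(\<lambda>a. a \<star> x) ` topspace X \<subseteq> L"
    using assms unfolding left_ideal_def by blast+
  then show ?thesis by (intro min left_ideal_principal)
qed

text \<open>Zorn's lemma gives minimality among closed left ideals only. Every left ideal contains
  some \<open>S x\<close>, with \<open>S\<close> for \<open>topspace X\<close>, and
  \<open>S x\<close> is closed as a continuous image of a compact set; so minimality holds among all
  left ideals.\<close>

lemma minimal_left_ideal_exists: "\<exists>L. minimal_left_ideal L"
proof -
  let ?P = "\<lambda>L. closedin X L \<and> left_ideal L"
  obtain L where L: "?P L" and min: "\<And>B. ?P B \<Longrightarrow> B \<subseteq> L \<Longrightarrow> B = L"
  proof (rule compact_space_minimal_closed[OF compact, of ?P "topspace X"])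
    show "?P (topspace X)" using nonempty by (auto simp: left_ideal_def)
    show "?P (\<Inter>\<C>)" if "\<C> \<noteq> {}" "\<And>A. A \<in> \<C> \<Longrightarrow> ?P A" "\<Inter>\<C> \<noteq> {}" for \<C>
    proof
      show "closedin X (\<Inter>\<C>)" using that by (intro closedin_Inter) auto
      show "left_ideal (\<Inter>\<C>)"
        unfolding left_ideal_def
      proof (intro conjI ballI)
        show "\<Inter>\<C> \<subseteq> topspace X" using that(1,2) unfolding left_ideal_def by blast
        show "a \<star> x \<in> \<Inter>\<C>" if "a \<in> topspace X" "x \<in> \<Inter>\<C>" for a x
          using that \<open>\<And>A. A \<in> \<C> \<Longrightarrow> ?P A\<close> unfolding left_ideal_def by blast
      qed (use that in blast)
    qed
  qed (auto simp: left_ideal_def)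
  have "minimal_left_ideal L"
    unfolding minimal_left_ideal_def
  proof (intro conjI allI impI)
    show "left_ideal L" using L by blast
    fix L' assume that: "left_ideal L'" "L' \<subseteq> L"
    obtain x where x: "x \<in> L'" "x \<in> topspace X"
      using \<open>left_ideal L'\<close> unfolding left_ideal_def by blast
    have "closedin X ((\<lambda>a. a \<star> x) ` topspace X)"
      using x by (intro closedin_image continuous_right) auto
    moreover have sub: "(\<lambda>a. a \<star> x) ` topspace X \<subseteq> L'"
      using x \<open>left_ideal L'\<close> unfolding left_ideal_def by blast
    ultimately have "(\<lambda>a. a \<star> x) ` topspace X = L"
      using left_ideal_principal[OF x(2)] that(2) by (intro min) auto
    with sub that(2) show "L' = L" by (intro antisym) simp_all
  qed
  then show ?thesis ..
qed

lemma ideal_left_ideal_mul: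
  assumes "left_ideal L"
  shows "ideal {x \<star> a |x a. x \<in> L \<and> a \<in> topspace X}" (is "ideal ?K")
  unfolding ideal_def
proof (intro conjI ballI)
  have LX: "L \<subseteq> topspace X" and "L \<noteq> {}" and LI: "\<And>a x. a \<in> topspace X \<Longrightarrow> x \<in> L \<Longrightarrow> a \<star> x \<in> L"
    using assms unfolding left_ideal_def by auto
  show "?K \<noteq> {}" using \<open>L \<noteq> {}\<close> nonempty by blast
  show "?K \<subseteq> topspace X" using LX by auto
  fix b y assume b: "b \<in> topspace X" and "y \<in> ?K"
  then obtain x a where y: "y = x \<star> a" "x \<in> L" "x \<in> topspace X" "a \<in> topspace X"
    using LX by blast
  have "b \<star> y = (b \<star> x) \<star> a" "y \<star> b = x \<star> (a \<star> b)"
    unfolding y(1) using y(3,4) b assoc by simp_all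
  moreover have "b \<star> x \<in> L" "a \<star> b \<in> topspace X"
    using LI y b by auto
  ultimately show "b \<star> y \<in> ?K" "y \<star> b \<in> ?K"
    using y b by blast+
qed

text \<open>Take \<open>L S\<close> for a minimal left ideal \<open>L\<close>. An ideal
  \<open>I\<close> meets \<open>L\<close> in some \<open>i x\<close>, so \<open>L = S (i x)\<close>
  lies in \<open>I\<close>, and so does \<open>L S\<close>.\<close>

lemma least_ideal_exists: "\<exists>K. least_ideal K"
proof -
  obtain L where L: "minimal_left_ideal L" using minimal_left_ideal_exists by blast
  then have LX: "L \<subseteq> topspace X" and "L \<noteq> {}" and left: "left_ideal L"
    unfolding minimal_left_ideal_def left_ideal_def by auto
  let ?K = "{x \<star> a |x a. x \<in> L \<and> a \<in> topspace X}"
  have "?K \<subseteq> I" if I: "ideal I" for I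
  proof -
    obtain i x where i: "i \<in> I" "i \<in> topspace X" and x: "x \<in> L" "x \<in> topspace X"
      using I LX \<open>L \<noteq> {}\<close> unfolding ideal_def by blast
    have "i \<star> x \<in> I" using I i x unfolding ideal_def by blast
    moreover have "i \<star> x \<in> L" using left i x unfolding left_ideal_def by blast
    ultimately have "L \<subseteq> I"
      using I minimal_left_idealD[OF L, of "i \<star> x"] unfolding ideal_def by blast
    then show ?thesis using I unfolding ideal_def by blast
  qed
  with ideal_left_ideal_mul[OF left] have "least_ideal ?K"
    unfolding least_ideal_def by (intro conjI allI impI)
  then show ?thesis ..
qed

text \<open>Write \<open>q = x c\<close> with \<open>x\<close> in a minimal left ideal
  \<open>L\<close>. Right multiplication by \<open>c\<close> carries \<open>L\<close> to
  \<open>S q\<close>, and a left ideal inside \<open>S q\<close> pulls back to a left ideal inside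
  \<open>L\<close>, which must be all of \<open>L\<close>.\<close>

lemma least_ideal_minimal_left:
  assumes K: "least_ideal K" and q: "q \<in> K"
  shows "minimal_left_ideal ((\<lambda>a. a \<star> q) ` topspace X)"
proof -
  obtain L where L: "minimal_left_ideal L" using minimal_left_ideal_exists by blast
  then have LX: "L \<subseteq> topspace X" and "L \<noteq> {}" and LI: "\<And>a x. a \<in> topspace X \<Longrightarrow> x \<in> L \<Longrightarrow> a \<star> x \<in> L"
    unfolding minimal_left_ideal_def left_ideal_def by auto
  have KX: "K \<subseteq> topspace X" using K unfolding least_ideal_def ideal_def by blast
  have "q \<in> {x \<star> a |x a. x \<in> L \<and> a \<in> topspace X}"
    using ideal_left_ideal_mul[of L] L K q
    unfolding minimal_left_ideal_def least_ideal_def by blast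
  then obtain x c where x: "q = x \<star> c" "x \<in> L" "c \<in> topspace X" by blast
  show ?thesis
    unfolding minimal_left_ideal_def
  proof (intro conjI allI impI antisym)
    show "left_ideal ((\<lambda>a. a \<star> q) ` topspace X)"
      using left_ideal_principal[of q] q KX by blast
    fix L' assume L': "left_ideal L'" "L' \<subseteq> (\<lambda>a. a \<star> q) ` topspace X"
    have "left_ideal {y \<in> L. y \<star> c \<in> L'}"
    proof -
      obtain z where "z \<in> L'" using L' unfolding left_ideal_def by blast
      then obtain a where a: "a \<in> topspace X" "z = a \<star> (x \<star> c)"
        using L' x by blast
      then have "z = (a \<star> x) \<star> c" using LX x by (auto simp: assoc)
      then have "a \<star> x \<in> {y \<in> L. y \<star> c \<in> L'}" using \<open>z \<in> L'\<close> LI a x by auto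
      moreover have "b \<star> y \<in> {y \<in> L. y \<star> c \<in> L'}"
        if "b \<in> topspace X" "y \<in> {y \<in> L. y \<star> c \<in> L'}" for b y
      proof -
        have y: "y \<in> L" "y \<star> c \<in> L'" "y \<in> topspace X" using that LX by auto
        have "b \<star> (y \<star> c) \<in> L'"
          using L' y that(1) unfolding left_ideal_def by blast
        then show ?thesis using LI y that(1) x assoc by simp
      qed
      ultimately show ?thesis
        using LX unfolding left_ideal_def by blast
    qed
    then have "{y \<in> L. y \<star> c \<in> L'} = L"
      using L unfolding minimal_left_ideal_def by simp
    with x(2) have "x \<in> {y \<in> L. y \<star> c \<in> L'}" by simp
    then have "q \<in> L'" using x by simp
    then show "(\<lambda>a. a \<star> q) ` topspace X \<subseteq> L'"
      using L' unfolding left_ideal_def by blast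
  qed
qed

text \<open>Two-sided ideals do not see the order of multiplication, so minimality of the
  \<open>S q\<close> transfers to the right ideals \<open>q S\<close>.\<close>

lemma opposite_least_ideal:
  "compact_semitop_semigroup.least_ideal X (\<lambda>x y. y \<star> x) K \<longleftrightarrow> least_ideal K"
proof -
  have "compact_semitop_semigroup.ideal X (\<lambda>x y. y \<star> x) I \<longleftrightarrow> ideal I" for I
    unfolding ideal_def compact_semitop_semigroup.ideal_def[OF opposite] by metis
  then show ?thesis
    unfolding least_ideal_def compact_semitop_semigroup.least_ideal_def[OF opposite] by simp
qed

lemma least_ideal_closed:
  assumes "least_ideal K" "x \<in> K"
  shows "x \<in> topspace X" "a \<in> topspace X \<Longrightarrow> a \<star> x \<in> K" "a \<in> topspace X \<Longrightarrow> x \<star> a \<in> K"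
  using assms unfolding least_ideal_def ideal_def by blast+

lemma least_ideal_left_eq:
  assumes K: "least_ideal K" and q: "q \<in> K" and r: "r = a \<star> q" "a \<in> topspace X"
  shows "(\<lambda>a. a \<star> r) ` topspace X = (\<lambda>a. a \<star> q) ` topspace X"
  by (rule minimal_left_idealD[OF least_ideal_minimal_left[OF K q]]) (use r in simp)

lemma least_ideal_right_eq:
  assumes K: "least_ideal K" and q: "q \<in> K" and r: "r = q \<star> a" "a \<in> topspace X"
  shows "(\<lambda>a. r \<star> a) ` topspace X = (\<lambda>a. q \<star> a) ` topspace X"
  by (rule compact_semitop_semigroup.least_ideal_left_eq[OF opposite _ q r])
    (simp add: K opposite_least_ideal)

lemma least_ideal_idempotent_exists:
  assumes K: "least_ideal K"
  shows "\<exists>p\<in>K. p \<star> p = p"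
proof -
  obtain x where x: "x \<in> K"
    using K unfolding least_ideal_def ideal_def by blast
  note xX = least_ideal_closed(1)[OF K x]
  let ?L = "(\<lambda>a. a \<star> x) ` topspace X"
  have LK: "?L \<subseteq> K" using least_ideal_closed[OF K x] by blast
  have "closedin X ?L" using xX by (intro closedin_image continuous_right) auto
  moreover have "?L \<noteq> {}" using nonempty by blast
  moreover have "a \<star> b \<in> ?L" if "a \<in> ?L" "b \<in> ?L" for a b
  proof -
    have "a \<in> topspace X" using that LK least_ideal_closed(1)[OF K] by blast
    then show ?thesis
      using left_ideal_principal[OF xX] that(2) unfolding left_ideal_def by blast
  qed
  ultimately obtain p where "p \<in> ?L" "p \<star> p = p" by (rule idempotent_exists)
  with LK show ?thesis by blast
qed

text \<open>Two idempotents \<open>p\<close>, \<open>q\<close> of the least ideal are linked through an idempotent of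
  \<open>q S p\<close>, which has the left ideal in common with \<open>p\<close> and the right ideal with \<open>q\<close>.\<close>

lemma least_ideal_unique_idempotent:
  assumes K: "least_ideal K"
    and left: "\<And>p r. \<lbrakk>p \<in> K; r \<in> K; p \<star> p = p; r \<star> r = r; p \<star> r = p; r \<star> p = r\<rbrakk> \<Longrightarrow> p = r"
    and right: "\<And>p r. \<lbrakk>p \<in> K; r \<in> K; p \<star> p = p; r \<star> r = r; p \<star> r = r; r \<star> p = p\<rbrakk> \<Longrightarrow> p = r"
  shows "\<exists>!p. p \<in> K \<and> p \<star> p = p"
proof -
  have "p = q" if p: "p \<in> K" "p \<star> p = p" and q: "q \<in> K" "q \<star> q = q" for p q
  proof -
    note pX = least_ideal_closed(1)[OF K p(1)] and qX = least_ideal_closed(1)[OF K q(1)]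
    let ?C = "(\<lambda>a. q \<star> a) ` (\<lambda>a. a \<star> p) ` topspace X"
    have "closedin X ?C"
      using pX qX by (intro closedin_image continuous_right continuous_left) auto
    moreover have "?C \<noteq> {}" using nonempty by blast
    moreover have "c \<star> d \<in> ?C" if cd: "c \<in> ?C" "d \<in> ?C" for c d
    proof -
      obtain a b where ab: "a \<in> topspace X" "b \<in> topspace X" "c = q \<star> (a \<star> p)" "d = q \<star> (b \<star> p)"
        using cd by blast
      have "c \<star> d = q \<star> ((a \<star> p \<star> q \<star> b) \<star> p)"
        using ab(1,2) pX qX unfolding ab(3,4) by (simp add: assoc)
      then show ?thesis using ab(1,2) pX qX by simp
    qed
    ultimately obtain r where r: "r \<in> ?C" "r \<star> r = r" by (rule idempotent_exists)
    then obtain a where a: "a \<in> topspace X" "r = q \<star> (a \<star> p)" by blast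
    have ra: "r = (q \<star> a) \<star> p" "q \<star> a \<in> topspace X" "a \<star> p \<in> topspace X"
      using a pX qX assoc by auto
    have rK: "r \<in> K" unfolding ra(1) using ra(2) least_ideal_closed(2)[OF K p(1)] by simp
    note rX = least_ideal_closed(1)[OF K rK]
    \<comment> \<open>Minimality gives \<open>S p = S r\<close>. From \<open>p = c r\<close> and
      \<open>r r = r\<close> follows \<open>p r = p\<close>; the right ideals of \<open>q\<close>
      and \<open>r\<close> are treated in the same way below.\<close>
    have "p \<in> (\<lambda>a. a \<star> p) ` topspace X" using p pX by (metis imageI)
    then have "p \<in> (\<lambda>a. a \<star> r) ` topspace X"
      using least_ideal_left_eq[OF K p(1) ra(1,2)] by simp
    then obtain c where c: "c \<in> topspace X" "p = c \<star> r" by blast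
    have "p \<star> r = p"
      using assoc[OF c(1) rX rX] unfolding c(2)[symmetric] r(2) .
    moreover have "r \<star> p = r"
      using assoc[OF ra(2) pX pX] unfolding ra(1)[symmetric] p(2) .
    ultimately have "p = r" using left p rK r(2) by simp
    have "q \<in> (\<lambda>a. q \<star> a) ` topspace X" using q qX by (metis imageI)
    then have "q \<in> (\<lambda>a. r \<star> a) ` topspace X"
      using least_ideal_right_eq[OF K q(1) a(2) ra(3)] by simp
    then obtain d where d: "d \<in> topspace X" "q = r \<star> d" by blast
    have "r \<star> q = q"
      using assoc[OF rX rX d(1)] unfolding d(2)[symmetric] r(2) by simp
    moreover have "q \<star> r = r"
      using assoc[OF qX qX ra(3)] unfolding a(2)[symmetric] q(2) by simp
    ultimately have "q = r" using right q rK r(2) by simp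
    with \<open>p = r\<close> show ?thesis by simp
  qed
  then show ?thesis using least_ideal_idempotent_exists[OF K] by blast
qed

lemma continuous_mul_left:
  "\<lbrakk>continuous_map X Y f; a \<in> topspace X\<rbrakk> \<Longrightarrow> continuous_map X Y (\<lambda>x. f (a \<star> x))"
  using continuous_map_compose[OF continuous_left[of a], of Y f] by (simp add: o_def)

lemma continuous_mul_right:
  "\<lbrakk>continuous_map X Y f; a \<in> topspace X\<rbrakk> \<Longrightarrow> continuous_map X Y (\<lambda>x. f (x \<star> a))"
  using continuous_map_compose[OF continuous_right[of a], of Y f] by (simp add: o_def)

end

section \<open>Dense subgroups\<close>

context compact_semitop_semigroup
begin

text \<open>Grothendieck's criterion: let \<open>z\<close> be a cluster point of \<open>x\<close>
  and \<open>(u, v)\<close> one of the pairs \<open>(a n, b n)\<close>. Taking the limit first in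
  \<open>m\<close> and then in \<open>n\<close> bounds \<open>\<bar>f (u z) - f (v z)\<bar>\<close>
  below by \<epsilon>; the other order makes it at most \<open>\<epsilon> / 2\<close>.\<close>

lemma double_limit:
  fixes f :: "'b \<Rightarrow> real"
  assumes f: "continuous_map X euclideanreal f" and "\<epsilon> > 0"
    and x: "\<And>n. x n \<in> topspace X" and a: "\<And>n. a n \<in> topspace X" and b: "\<And>n. b n \<in> topspace X"
    and near: "\<And>k. (\<lambda>n. f (a n \<star> x k) - f (b n \<star> x k)) \<longlonglongrightarrow> 0"
    and far: "\<And>n m :: nat. n < m \<Longrightarrow> \<epsilon> \<le> \<bar>f (a n \<star> x m) - f (b n \<star> x m)\<bar>"
  shows False
proof -
  obtain z where z: "z \<in> topspace X"
    and zC: "\<And>C. closedin X C \<Longrightarrow> \<forall>\<^sub>F n in sequentially. x n \<in> C \<Longrightarrow> z \<in> C"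
    by (rule compact_space_sequence_cluster[OF compact x]) (rule that)
  \<comment> \<open>The cluster point is taken in the product: separate cluster points of
    \<open>a\<close> and \<open>b\<close> would not control the difference.\<close>
  have "compact_space (prod_topology X X)"
    using compact by (simp add: compact_space_prod_topology)
  moreover have "(a n, b n) \<in> topspace (prod_topology X X)" for n
    using a b by simp
  ultimately obtain w where w: "w \<in> topspace (prod_topology X X)"
    and wC: "\<And>C. closedin (prod_topology X X) C \<Longrightarrow>
      \<forall>\<^sub>F n in sequentially. (a n, b n) \<in> C \<Longrightarrow> w \<in> C"
    by (rule compact_space_sequence_cluster[where x = "\<lambda>n. (a n, b n)"]) (rule that)
  obtain u v where uv: "w = (u, v)" "u \<in> topspace X" "v \<in> topspace X"
    using w by auto
  have cont: "continuous_map (prod_topology X X) euclideanreal (\<lambda>w. \<bar>f (fst w \<star> c) - f (snd w \<star> c)\<bar>)"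
    if "c \<in> topspace X" for c
    using continuous_map_compose[OF continuous_map_fst continuous_mul_right[OF f that]]
      continuous_map_compose[OF continuous_map_snd continuous_mul_right[OF f that]]
    by (intro continuous_map_real_abs continuous_map_diff) (simp_all add: o_def)
  have "\<epsilon> \<le> \<bar>f (a n \<star> z) - f (b n \<star> z)\<bar>" for n
  proof -
    have "z \<in> {c \<in> topspace X. \<epsilon> \<le> \<bar>f (a n \<star> c) - f (b n \<star> c)\<bar>}"
    proof (rule zC)
      show "closedin X {c \<in> topspace X. \<epsilon> \<le> \<bar>f (a n \<star> c) - f (b n \<star> c)\<bar>}"
        by (intro closedin_le_preimage continuous_map_real_abs continuous_map_diff
            continuous_mul_left[OF f] a b continuous_map_const[THEN iffD2]) simp
      show "\<forall>\<^sub>F m in sequentially. x m \<in> {c \<in> topspace X. \<epsilon> \<le> \<bar>f (a n \<star> c) - f (b n \<star> c)\<bar>}"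
        using eventually_gt_at_top[of n] by eventually_elim (simp add: x far)
    qed
    then show ?thesis by simp
  qed
  then have "w \<in> {w \<in> topspace (prod_topology X X). \<epsilon> \<le> \<bar>f (fst w \<star> z) - f (snd w \<star> z)\<bar>}"
    by (intro wC closedin_le_preimage cont[OF z]) (simp_all add: a b)
  then have 1: "\<epsilon> \<le> \<bar>f (u \<star> z) - f (v \<star> z)\<bar>" by (simp add: uv)
  have 2: "\<bar>f (u \<star> x k) - f (v \<star> x k)\<bar> \<le> \<delta>" if "\<delta> > 0" for k \<delta>
  proof -
    have "w \<in> {w \<in> topspace (prod_topology X X). \<bar>f (fst w \<star> x k) - f (snd w \<star> x k)\<bar> \<le> \<delta>}"
    proof (intro wC closedin_le_preimage cont[OF x])
      have "\<forall>\<^sub>F n in sequentially. \<bar>f (a n \<star> x k) - f (b n \<star> x k)\<bar> < \<delta>"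
        using tendstoD[OF near that, of k] by simp
      then show "\<forall>\<^sub>F n in sequentially. (a n, b n) \<in>
          {w \<in> topspace (prod_topology X X). \<bar>f (fst w \<star> x k) - f (snd w \<star> x k)\<bar> \<le> \<delta>}"
        by eventually_elim (simp add: a b)
    qed simp
    then show ?thesis by (simp add: uv)
  qed
  have "z \<in> {c \<in> topspace X. \<bar>f (u \<star> c) - f (v \<star> c)\<bar> \<le> \<epsilon> / 2}"
  proof (rule zC)
    show "closedin X {c \<in> topspace X. \<bar>f (u \<star> c) - f (v \<star> c)\<bar> \<le> \<epsilon> / 2}"
      by (intro closedin_le_preimage continuous_map_real_abs continuous_map_diff
          continuous_mul_left[OF f] uv continuous_map_const[THEN iffD2]) simp
    show "\<forall>\<^sub>F m in sequentially. x m \<in> {c \<in> topspace X. \<bar>f (u \<star> c) - f (v \<star> c)\<bar> \<le> \<epsilon> / 2}"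
      using \<open>\<epsilon> > 0\<close> x 2[of "\<epsilon> / 2"] by (intro always_eventually allI CollectI conjI) simp_all
  qed
  with 1 \<open>\<epsilon> > 0\<close> show False by simp
qed

text \<open>Inverses enter only as elements of \<open>topspace X\<close> that undo left
  multiplication by \<open>g\<close>. In this form the hypothesis can be checked in the opposite
  semigroup as well.\<close>

lemma dense_group_left_equivalent_idempotents:
  assumes G: "G \<subseteq> topspace X" "X closure_of G = topspace X"
    and GG: "\<And>g h. g \<in> G \<Longrightarrow> h \<in> G \<Longrightarrow> g \<star> h \<in> G"
    and inv: "\<And>g. g \<in> G \<Longrightarrow> \<exists>y\<in>topspace X. \<forall>x\<in>topspace X. y \<star> (g \<star> x) = x"
    and p: "p \<in> topspace X" and q: "q \<in> topspace X"
    and pp: "p \<star> p = p" and pq: "p \<star> q = p" and qp: "q \<star> p = q"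
  shows "p = q"
proof (rule ccontr)
  assume "p \<noteq> q"
  then have "disjnt {p} {q}" by simp
  with normal closedin_singleton[OF p] closedin_singleton[OF q]
  obtain f :: "'b \<Rightarrow> real" where f: "continuous_map X euclideanreal f" and "f ` {p} \<subseteq> {0}" "f ` {q} \<subseteq> {1}"
    by (rule Urysohn_lemma_alt)
  then have fpq: "f p = 0" "f q = 1" by auto
  have dense: "\<exists>g\<in>G. g \<in> U" if "openin X U" "u \<in> U" for U u
    using G(2) that dense_intersects_open[of X G] by blast
  have GX: "g \<in> topspace X" if "g \<in> G" for g using G(1) that by blast
  \<comment> \<open>One stage of the construction: a pair \<open>y\<close>, \<open>y'\<close> that
    is \<delta>-close on the points \<open>A\<close> met so far, but at least \<open>1/4\<close>
    apart on a whole open set \<open>U'\<close> inside \<open>U\<close>, from which all later points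
    will be taken.\<close>
  have step: "\<exists>y\<in>topspace X. \<exists>y'\<in>topspace X. \<exists>U' g'. (\<forall>x\<in>A. \<bar>f (y \<star> x) - f (y' \<star> x)\<bar> < \<delta>) \<and>
      openin X U' \<and> U' \<subseteq> U \<and> g' \<in> G \<and> g' \<star> p \<in> U' \<and>
      (\<forall>w\<in>U'. 1/4 \<le> \<bar>f (y \<star> w) - f (y' \<star> w)\<bar>)"
    if A: "finite A" "A \<subseteq> topspace X" and U: "openin X U" and g: "g \<in> G" "g \<star> p \<in> U"
      and \<delta>: "0 < \<delta>" "\<delta> \<le> 1/8" for A U g and \<delta> :: real
  proof -
    \<comment> \<open>The net is fixed before \<open>y\<close> is known, so that \<open>V\<close>
      can be chosen small for every candidate \<open>y'\<close> at once.\<close>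
    obtain Y where Y: "finite Y" "Y \<subseteq> topspace X"
      "\<And>y. y \<in> topspace X \<Longrightarrow> \<exists>y'\<in>Y. \<forall>h\<in>(\<lambda>a y. f (y \<star> a)) ` A. \<bar>h y - h y'\<bar> < \<delta>"
    proof (rule compact_space_finite_net[OF compact, of "(\<lambda>a y. f (y \<star> a)) ` A" \<delta>])
      show "continuous_map X euclideanreal h" if "h \<in> (\<lambda>a y. f (y \<star> a)) ` A" for h
        using that A(2) f continuous_mul_right by auto
    qed (use A \<delta> in auto)
    define V where "V = U \<inter> {w \<in> topspace X. \<forall>h\<in>(\<lambda>y w. \<bar>f (y \<star> w) - f (y \<star> (g \<star> p))\<bar>) ` Y. h w < \<delta>}"
    have gp: "g \<star> p \<in> topspace X" using g p GX by simp
    have openV: "openin X V"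
    proof -
      have "openin X {w \<in> topspace X. \<bar>f (y \<star> w) - f (y \<star> (g \<star> p))\<bar> \<in> {..<\<delta>}}" if "y \<in> Y" for y
      proof (rule openin_continuous_map_preimage)
        show "continuous_map X euclideanreal (\<lambda>w. \<bar>f (y \<star> w) - f (y \<star> (g \<star> p))\<bar>)"
          using that Y(2) by (intro continuous_map_real_abs continuous_map_diff continuous_mul_left[OF f]
              continuous_map_const[THEN iffD2]) auto
      qed simp
      then have "openin X (U \<inter> ((\<Inter>y\<in>Y. {w \<in> topspace X. \<bar>f (y \<star> w) - f (y \<star> (g \<star> p))\<bar> \<in> {..<\<delta>}}) \<inter> topspace X))"
        by (intro openin_Int U openin_INT Y(1))
      moreover have "U \<inter> ((\<Inter>y\<in>Y. {w \<in> topspace X. \<bar>f (y \<star> w) - f (y \<star> (g \<star> p))\<bar> \<in> {..<\<delta>}}) \<inter> topspace X) = V"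
        unfolding V_def by auto
      ultimately show ?thesis by simp
    qed
    have gpV: "g \<star> p \<in> V" using g gp \<delta> by (simp add: V_def)
    \<comment> \<open>Since \<open>p p = p = p q\<close>, both \<open>h \<mapsto> g h p\<close> and
      \<open>h \<mapsto> g h q\<close> take the value \<open>g p\<close> at \<open>h = p\<close>. An
      \<open>h\<close> in \<open>G\<close> near \<open>p\<close> therefore puts both points into
      \<open>V\<close>.\<close>
    have "openin X ({h \<in> topspace X. g \<star> (h \<star> p) \<in> V} \<inter> {h \<in> topspace X. g \<star> (h \<star> q) \<in> V})"
      using openV p q g GX
      by (intro openin_Int openin_continuous_map_preimage[OF continuous_mul_right[OF continuous_left]]) auto
    moreover have "p \<in> {h \<in> topspace X. g \<star> (h \<star> p) \<in> V} \<inter> {h \<in> topspace X. g \<star> (h \<star> q) \<in> V}"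
      using p gpV by (simp add: pp pq)
    ultimately obtain h where h: "h \<in> G" "g \<star> (h \<star> p) \<in> V" "g \<star> (h \<star> q) \<in> V"
      using dense by blast
    have hX: "h \<in> topspace X" "g \<in> topspace X" and gh: "g \<star> h \<in> G" using h g GX GG by auto
    obtain y where y: "y \<in> topspace X" "\<And>x. x \<in> topspace X \<Longrightarrow> y \<star> (g \<star> h \<star> x) = x"
      using inv[OF gh] by blast
    have yp: "f (y \<star> (g \<star> (h \<star> p))) = 0" "f (y \<star> (g \<star> (h \<star> q))) = 1"
      using y(2)[OF p] y(2)[OF q] hX p q fpq by (simp_all add: assoc)
    obtain y' where y': "y' \<in> Y" "\<And>a. a \<in> A \<Longrightarrow> \<bar>f (y \<star> a) - f (y' \<star> a)\<bar> < \<delta>"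
      using Y(3)[OF y(1)] by auto
    define c where "c = f (y' \<star> (g \<star> p))"
    have V: "\<bar>f (y' \<star> w) - c\<bar> < \<delta>" "w \<in> U" "w \<in> topspace X" if "w \<in> V" for w
      using that y'(1) by (auto simp: V_def c_def)
    \<comment> \<open>The function \<open>f (y _)\<close> takes the values \<open>0\<close> and
      \<open>1\<close> at the two points, and one of these is at distance at least
      \<open>1/2\<close> from \<open>c\<close>. Both points lie in \<open>S p\<close>, the second
      because \<open>q = q p\<close>.\<close>
    obtain w0 where w0: "w0 \<in> V" "1/2 \<le> \<bar>f (y \<star> w0) - c\<bar>" "\<exists>k\<in>topspace X. w0 = k \<star> p"
    proof (cases "1/2 \<le> \<bar>c\<bar>")
      case True
      have "g \<star> (h \<star> p) = g \<star> h \<star> p" using hX p by (simp add: assoc)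
      then show thesis using that[of "g \<star> (h \<star> p)"] True h yp hX p by auto
    next
      case False
      have "g \<star> (h \<star> q) = g \<star> h \<star> q \<star> p" using hX p q qp by (simp add: assoc)
      then have "\<exists>k\<in>topspace X. g \<star> (h \<star> q) = k \<star> p" using hX q by blast
      moreover have "1/2 \<le> \<bar>f (y \<star> (g \<star> (h \<star> q))) - c\<bar>" unfolding yp using False by linarith
      ultimately show thesis using that[of "g \<star> (h \<star> q)"] h by blast
    qed
    define U' where "U' = V \<inter> {w \<in> topspace X. \<bar>f (y \<star> w) - f (y \<star> w0)\<bar> \<in> {..<\<delta>}}"
    have openU': "openin X U'"
      unfolding U'_def
      by (intro openin_Int openV openin_continuous_map_preimage[where Y = euclideanreal]
          continuous_map_real_abs continuous_map_diff continuous_mul_left[OF f] y continuous_map_const[THEN iffD2])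
        simp_all
    obtain k where k: "k \<in> topspace X" "w0 = k \<star> p" using w0 by blast
    \<comment> \<open>Density is used once more, near \<open>k\<close>, to return from
      \<open>k p\<close> to a point \<open>g' p\<close> with \<open>g'\<close> in
      \<open>G\<close>.\<close>
    have "openin X {k \<in> topspace X. k \<star> p \<in> U'}"
      using openU' continuous_right[OF p] by (rule openin_continuous_map_preimage[rotated])
    moreover have "k \<in> {k \<in> topspace X. k \<star> p \<in> U'}"
      using k w0(1) V(3) \<delta> by (auto simp: U'_def)
    ultimately obtain g' where g': "g' \<in> G" "g' \<star> p \<in> U'" using dense by blast
    \<comment> \<open>The separation \<open>1/2\<close> loses less than \<delta> twice, and \<delta>
      is at most \<open>1/8\<close>.\<close>
    have far: "1/4 \<le> \<bar>f (y \<star> w) - f (y' \<star> w)\<bar>" if "w \<in> U'" for w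
    proof -
      have "\<bar>f (y \<star> w) - f (y \<star> w0)\<bar> < \<delta>" "\<bar>f (y' \<star> w) - c\<bar> < \<delta>"
        using that V(1) by (auto simp: U'_def)
      with w0(2) \<delta> show ?thesis by linarith
    qed
    have "U' \<subseteq> U" using V(2) by (auto simp: U'_def)
    with y(1) y' Y(2) openU' g' far show ?thesis by blast
  qed
  \<comment> \<open>A state consists of the points met so far, the current open set, the current
    group element and the last pair. \<open>Q\<close> makes the new pair close on the old points and
    separated on the new open set.\<close>
  define P where "P = (\<lambda>(n::nat) (A, U, g, y, y'). finite A \<and> A \<subseteq> topspace X \<and> openin X U \<and> g \<in> G \<and>
    g \<star> p \<in> U \<and> g \<star> p \<in> A \<and> y \<in> topspace X \<and> y' \<in> topspace X)"
  define Q where "Q = (\<lambda>(n::nat) (A, U, g :: 'b, y :: 'b, y' :: 'b) (A', U', g' :: 'b, v, v').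
    A \<subseteq> A' \<and> U' \<subseteq> U \<and> (\<forall>x\<in>A. \<bar>f (v \<star> x) - f (v' \<star> x)\<bar> < 1 / (real n + 8)) \<and>
    (\<forall>w\<in>U'. 1/4 \<le> \<bar>f (v \<star> w) - f (v' \<star> w)\<bar>))"
  obtain \<sigma> where \<sigma>: "\<And>n. P n (\<sigma> n)" "\<And>n. Q n (\<sigma> n) (\<sigma> (Suc n))"
  proof (rule dependent_nat_choice[of P Q, THEN exE])
    obtain g where "g \<in> G" using dense[OF openin_topspace p] by blast
    \<comment> \<open>The pair \<open>(p, p)\<close> of the initial state is a placeholder; only
      pairs with index \<open>Suc n\<close> are used.\<close>
    then have "P 0 ({g \<star> p}, topspace X, g, p, p)" using p GX by (simp add: P_def)
    then show "\<exists>x. P 0 x" ..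
    fix s n assume "P n s"
    obtain A U g y y' where s: "s = (A, U, g, y, y')" by (cases s)
    have *: "finite A" "A \<subseteq> topspace X" "openin X U" "g \<in> G" "g \<star> p \<in> U"
      using \<open>P n s\<close> by (simp_all add: P_def s)
    have "(0::real) < 1 / (real n + 8)" "1 / (real n + 8) \<le> (1/8 :: real)" by (simp_all add: field_simps)
    from step[OF * this] obtain v v' U' g' where
      v: "v \<in> topspace X" "v' \<in> topspace X" "\<forall>x\<in>A. \<bar>f (v \<star> x) - f (v' \<star> x)\<bar> < 1 / (real n + 8)"
      "openin X U'" "U' \<subseteq> U" "g' \<in> G" "g' \<star> p \<in> U'" "\<forall>w\<in>U'. 1/4 \<le> \<bar>f (v \<star> w) - f (v' \<star> w)\<bar>"
      by blast
    have "P (Suc n) (insert (g' \<star> p) A, U', g', v, v')" "Q n s (insert (g' \<star> p) A, U', g', v, v')"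
      using * v p GX by (auto simp: P_def Q_def s)
    then show "\<exists>s'. P (Suc n) s' \<and> Q n s s'" by blast
  qed blast
  define A U g y y' where "A n = fst (\<sigma> n)" and "U n = fst (snd (\<sigma> n))"
    and "g n = fst (snd (snd (\<sigma> n)))" and "y n = fst (snd (snd (snd (\<sigma> n))))"
    and "y' n = snd (snd (snd (snd (\<sigma> n))))" for n
  have \<sigma>_eq: "\<sigma> n = (A n, U n, g n, y n, y' n)" for n
    by (simp add: A_def U_def g_def y_def y'_def)
  have P: "g n \<in> G" "g n \<star> p \<in> U n" "g n \<star> p \<in> A n" "y n \<in> topspace X" "y' n \<in> topspace X" for n
    using \<sigma>(1)[of n] by (simp_all add: P_def \<sigma>_eq)
  have Q: "A n \<subseteq> A (Suc n)" "U (Suc n) \<subseteq> U n"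
    "\<And>x. x \<in> A n \<Longrightarrow> \<bar>f (y (Suc n) \<star> x) - f (y' (Suc n) \<star> x)\<bar> < 1 / (real n + 8)"
    "\<And>w. w \<in> U (Suc n) \<Longrightarrow> 1/4 \<le> \<bar>f (y (Suc n) \<star> w) - f (y' (Suc n) \<star> w)\<bar>" for n
    using \<sigma>(2)[of n] by (simp_all add: Q_def \<sigma>_eq)
  have A_mono: "A k \<subseteq> A n" if "k \<le> n" for k n
    using that by (rule lift_Suc_mono_le[of A, OF Q(1)])
  have U_anti: "U n \<subseteq> U k" if "k \<le> n" for k n
    using that by (rule lift_Suc_antimono_le[of U, OF Q(2)])
  show False
  \<comment> \<open>The pair with index \<open>Suc n\<close> is chosen after \<open>A n\<close>: it
    is close on \<open>g k p\<close> for \<open>k \<le> n\<close> and separated on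
    \<open>U (Suc n)\<close>, which contains \<open>g m p\<close> for \<open>m > n\<close>.\<close>
  proof (rule double_limit[OF f, of "1/4" "\<lambda>n. g n \<star> p" "\<lambda>n. y (Suc n)" "\<lambda>n. y' (Suc n)"])
    show "g n \<star> p \<in> topspace X" for n using P(1) GX p by simp
    show "(\<lambda>n. f (y (Suc n) \<star> (g k \<star> p)) - f (y' (Suc n) \<star> (g k \<star> p))) \<longlonglongrightarrow> 0" for k
    proof (rule tendsto_rabs_zero_cancel, rule tendsto_sandwich[OF _ _ tendsto_const])
      show "\<forall>\<^sub>F n in sequentially. \<bar>f (y (Suc n) \<star> (g k \<star> p)) - f (y' (Suc n) \<star> (g k \<star> p))\<bar> \<le> 1 / (real n + 8)"
        using eventually_ge_at_top[of k]
      proof eventually_elim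
        case (elim n)
        then have "g k \<star> p \<in> A n" using A_mono P(3) by blast
        then show ?case using Q(3) by (simp add: less_imp_le)
      qed
      show "(\<lambda>n. 1 / (real n + 8)) \<longlonglongrightarrow> 0"
        using LIMSEQ_ignore_initial_segment[OF lim_1_over_n, of 8] by simp
    qed simp
    show "1/4 \<le> \<bar>f (y (Suc n) \<star> (g m \<star> p)) - f (y' (Suc n) \<star> (g m \<star> p))\<bar>" if "n < m" for n m
    proof -
      have "g m \<star> p \<in> U (Suc n)" using U_anti[of "Suc n" m] that P(2) by auto
      then show ?thesis by (rule Q(4))
    qed
  qed (simp_all add: P)
qed

end

section \<open>Invariant means\<close>

lemma continuous_map_Max:
  fixes h :: "'i \<Rightarrow> 'b \<Rightarrow> real"
  assumes "finite J" "J \<noteq> {}" "\<And>j. j \<in> J \<Longrightarrow> continuous_map X euclideanreal (h j)"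
  shows "continuous_map X euclideanreal (\<lambda>x. Max ((\<lambda>j. h j x) ` J))"
  using assms
proof (induction J rule: finite_ne_induct)
  case (insert j J)
  then have "continuous_map X euclideanreal (\<lambda>x. max (h j x) (Max ((\<lambda>j. h j x) ` J)))"
    by (intro continuous_map_real_max) auto
  with insert show ?case by simp
qed simp

text \<open>Monotonicity expresses positivity and also makes \<open>\<Lambda> f\<close> depend only
  on the values of \<open>f\<close> on \<open>topspace X\<close>.\<close>

locale topological_mean =
  fixes X :: "'b topology" and \<Lambda> :: "('b \<Rightarrow> real) \<Rightarrow> real"
  assumes mono: "\<lbrakk>continuous_map X euclideanreal f; continuous_map X euclideanreal g;
      \<And>x. x \<in> topspace X \<Longrightarrow> f x \<le> g x\<rbrakk> \<Longrightarrow> \<Lambda> f \<le> \<Lambda> g"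
    and add: "\<lbrakk>continuous_map X euclideanreal f; continuous_map X euclideanreal g\<rbrakk> \<Longrightarrow>
      \<Lambda> (\<lambda>x. f x + g x) = \<Lambda> f + \<Lambda> g"
    and const: "\<Lambda> (\<lambda>x. c) = c"
begin

lemma diff:
  assumes "continuous_map X euclideanreal f" "continuous_map X euclideanreal g"
  shows "\<Lambda> (\<lambda>x. f x - g x) = \<Lambda> f - \<Lambda> g"
  using add[OF continuous_map_diff[OF assms] assms(2)] by simp

text \<open>A dominated convergence theorem for positive functionals on \<open>C(X)\<close>, without a representing
  measure. With \<open>\<alpha> N\<close> the supremum of \<open>\<Lambda>\<close> over finite maxima of \<open>h j\<close>, \<open>j \<ge> N\<close>, choose maxima
  \<open>H (J N)\<close> that nearly attain \<open>\<alpha> N\<close>; since \<open>max a b + min a b = a + b\<close>, the finite minima of the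
  \<open>H (J N)\<close> keep a large value of \<open>\<Lambda>\<close>, which gives a point where infinitely many \<open>h j\<close> are large.\<close>

lemma pointwise_null_sequence:
  fixes h :: "nat \<Rightarrow> 'b \<Rightarrow> real"
  assumes X: "compact_space X" and h: "\<And>n. continuous_map X euclideanreal (h n)"
    and bound: "\<And>n x. x \<in> topspace X \<Longrightarrow> h n x \<le> B"
    and lim: "\<And>x. x \<in> topspace X \<Longrightarrow> (\<lambda>n. h n x) \<longlonglongrightarrow> 0"
    and "\<delta> > 0"
  shows "\<exists>n. \<Lambda> (h n) < \<delta>"
proof (rule ccontr)
  assume "\<not> ?thesis"
  then have large: "\<delta> \<le> \<Lambda> (h n)" for n by (simp add: not_less)
  define H where "H J x = Max ((\<lambda>j. h j x) ` J)" for J x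
  define \<J> where "\<J> N = {J. finite J \<and> J \<noteq> {} \<and> J \<subseteq> {N..}}" for N :: nat
  define \<alpha> where "\<alpha> N = (SUP J\<in>\<J> N. \<Lambda> (H J))" for N
  have \<J>: "finite J" "J \<noteq> {}" if "J \<in> \<J> N" for J N
    using that by (auto simp: \<J>_def)
  have H: "continuous_map X euclideanreal (H J)" if "J \<in> \<J> N" for J N
    unfolding H_def using \<J>[OF that] h by (rule continuous_map_Max)
  have bdd: "bdd_above ((\<lambda>J. \<Lambda> (H J)) ` \<J> N)" for N
  proof (rule bdd_aboveI2)
    fix J assume J: "J \<in> \<J> N"
    have "\<Lambda> (H J) \<le> \<Lambda> (\<lambda>x. B)"
      using \<J>[OF J] bound by (intro mono H[OF J]) (auto simp: H_def)
    then show "\<Lambda> (H J) \<le> B" by (simp add: const)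
  qed
  have le_\<alpha>: "\<Lambda> (H J) \<le> \<alpha> N" if "J \<in> \<J> N" for J N
    unfolding \<alpha>_def by (rule cSUP_upper[OF that bdd])
  have "\<delta> \<le> \<alpha> N" for N
  proof -
    have "{N} \<in> \<J> N" by (simp add: \<J>_def)
    from le_\<alpha>[OF this] have "\<Lambda> (H {N}) \<le> \<alpha> N" .
    moreover have "H {N} = h N" by (simp add: H_def fun_eq_iff)
    ultimately show ?thesis using large[of N] by simp
  qed
  \<comment> \<open>The errors \<open>\<delta> / 2 ^ (N + 2)\<close> sum to
    \<open>\<delta> / 2\<close>, which leaves half of the lower bound \<delta> for the minima
    \<open>D N\<close>.\<close>
  have "\<exists>J\<in>\<J> N. \<alpha> N - \<delta> / 2 ^ (N + 2) < \<Lambda> (H J)" for N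
  proof -
    have "{N} \<in> \<J> N" by (simp add: \<J>_def)
    then have "\<J> N \<noteq> {}" by blast
    moreover have "\<alpha> N - \<delta> / 2 ^ (N + 2) < (SUP J\<in>\<J> N. \<Lambda> (H J))"
      unfolding \<alpha>_def[symmetric] using \<open>\<delta> > 0\<close> by simp
    ultimately show ?thesis using less_cSUP_iff[OF _ bdd] by blast
  qed
  then obtain J where J: "\<And>N. J N \<in> \<J> N" "\<And>N. \<alpha> N - \<delta> / 2 ^ (N + 2) < \<Lambda> (H (J N))"
    by metis
  define D where "D = rec_nat (H (J 0)) (\<lambda>N d x. min (H (J (Suc N)) x) (d x))"
  have D0: "D 0 = H (J 0)" and DS: "D (Suc N) = (\<lambda>x. min (H (J (Suc N)) x) (D N x))" for N
    by (simp_all add: D_def)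
  have D: "continuous_map X euclideanreal (D N)" for N
  proof (induction N)
    case (Suc N)
    then show ?case unfolding DS by (intro continuous_map_real_min H[OF J(1)])
  qed (simp add: D0 H[OF J(1)])
  have D_le: "D N x \<le> H (J N) x" for N x
    by (cases N) (simp_all add: D0 DS)
  have D_anti: "D n x \<le> D k x" if "k \<le> n" for k n x
    using that by (rule lift_Suc_antimono_le[of "\<lambda>n. D n x", rotated]) (simp add: DS)
  have \<Lambda>D: "\<alpha> N - (\<delta> / 2 - \<delta> / 2 ^ (N + 2)) \<le> \<Lambda> (D N)" for N
  proof (induction N)
    case 0
    show ?case using J(2)[of 0] by (simp add: D0)
  next
    case (Suc N)
    \<comment> \<open>The maximum of \<open>D N\<close> and \<open>H (J (Suc N))\<close> is at most
      \<open>H ?K\<close>, and \<open>\<Lambda> (H ?K) \<le> \<alpha> N\<close> because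
      \<open>?K\<close> is admissible for \<open>N\<close>. The term \<open>\<alpha> N\<close> then
      cancels against the induction hypothesis.\<close>
    let ?K = "J (Suc N) \<union> J N"
    have K: "?K \<in> \<J> N" using J(1)[of N] J(1)[of "Suc N"] by (auto simp: \<J>_def)
    have "D N x + H (J (Suc N)) x - H ?K x \<le> D (Suc N) x" for x
    proof -
      have "H ?K x = max (H (J (Suc N)) x) (H (J N) x)"
        using \<J>[OF J(1)] unfolding H_def image_Un by (intro Max_Un) auto
      with D_le[of N x] show ?thesis by (auto simp: DS)
    qed
    then have "\<Lambda> (\<lambda>x. D N x + H (J (Suc N)) x - H ?K x) \<le> \<Lambda> (D (Suc N))"
      by (intro mono continuous_map_diff continuous_map_add D H[OF J(1)] H[OF K])
    moreover have "\<Lambda> (\<lambda>x. D N x + H (J (Suc N)) x - H ?K x) = \<Lambda> (D N) + \<Lambda> (H (J (Suc N))) - \<Lambda> (H ?K)"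
      using diff[OF continuous_map_add[OF D H[OF J(1)]] H[OF K]] add[OF D H[OF J(1)]] by simp
    moreover have "\<Lambda> (H ?K) \<le> \<alpha> N" by (rule le_\<alpha>[OF K])
    moreover have "\<alpha> (Suc N) - \<delta> / 2 ^ (Suc N + 2) < \<Lambda> (H (J (Suc N)))" by (rule J(2))
    moreover have "\<delta> / 2 ^ (N + 2) = 2 * (\<delta> / 2 ^ (Suc N + 2))" by simp
    ultimately show ?case using Suc by linarith
  qed
  have "\<exists>x\<in>topspace X. \<delta> / 4 \<le> D N x" for N
  proof (rule ccontr)
    assume "\<not> ?thesis"
    then have "\<Lambda> (D N) \<le> \<Lambda> (\<lambda>x. \<delta> / 4)"
      by (intro mono D) (auto simp: not_le less_imp_le)
    moreover have "\<delta> / 2 ^ (N + 2) > 0" using \<open>\<delta> > 0\<close> by simp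
    ultimately show False
      using \<Lambda>D[of N] \<open>\<delta> \<le> \<alpha> N\<close> \<open>\<delta> > 0\<close> unfolding const by linarith
  qed
  then obtain x where x: "\<And>N. x N \<in> topspace X" "\<And>N. \<delta> / 4 \<le> D N (x N)" by metis
  obtain z where z: "z \<in> topspace X"
    and zC: "\<And>C. closedin X C \<Longrightarrow> \<forall>\<^sub>F n in sequentially. x n \<in> C \<Longrightarrow> z \<in> C"
    by (rule compact_space_sequence_cluster[OF X x(1)]) (rule that)
  \<comment> \<open>Since \<open>D\<close> decreases in its index, \<open>D N\<close> is at least
    \<open>\<delta> / 4\<close> at every \<open>x n\<close> with \<open>n \<ge> N\<close>, hence
    also at \<open>z\<close>.\<close>
  have *: "\<exists>j\<ge>N. \<delta> / 4 \<le> h j z" for N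
  proof -
    have "z \<in> {x \<in> topspace X. \<delta> / 4 \<le> D N x}"
    proof (rule zC)
      show "closedin X {x \<in> topspace X. \<delta> / 4 \<le> D N x}"
        by (intro closedin_le_preimage D) simp
      show "\<forall>\<^sub>F n in sequentially. x n \<in> {x \<in> topspace X. \<delta> / 4 \<le> D N x}"
        using eventually_ge_at_top[of N]
      proof eventually_elim
        case (elim n)
        with x(1)[of n] x(2)[of n] D_anti[OF elim, of "x n"] show ?case by simp
      qed
    qed
    then have "\<delta> / 4 \<le> H (J N) z" using D_le[of N z] by simp
    moreover have "H (J N) z \<in> (\<lambda>j. h j z) ` J N"
      unfolding H_def using \<J>[OF J(1)] by (intro Max_in) auto
    moreover have "J N \<subseteq> {N..}" using J(1)[of N] by (simp add: \<J>_def)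
    ultimately show ?thesis by auto
  qed
  have "\<forall>\<^sub>F n in sequentially. h n z < \<delta> / 4"
    using order_tendstoD(2)[OF lim[OF z], of "\<delta> / 4"] \<open>\<delta> > 0\<close> by simp
  then obtain N where "\<And>n. n \<ge> N \<Longrightarrow> h n z < \<delta> / 4"
    by (auto simp: eventually_sequentially)
  with *[of N] show False by (meson not_le)
qed

end

section \<open>From invariance under a dense set to invariance under the whole semigroup\<close>

context compact_semitop_semigroup
begin

text \<open>Density alone would give a net. Sequences suffice by an Eberlein-type argument: test
  points in \<open>X\<close> and elements of \<open>T\<close> are chosen alternately, and
  compactness is used in both variables.\<close>

lemma sequential_approximation:
  fixes f :: "'b \<Rightarrow> real"
  assumes T: "T \<subseteq> topspace X" "X closure_of T = topspace X"
    and f: "continuous_map X euclideanreal f" and u: "u \<in> topspace X"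
  obtains s where "\<And>n :: nat. s n \<in> T"
    "\<And>x. x \<in> topspace X \<Longrightarrow> (\<lambda>n. f (s n \<star> x)) \<longlonglongrightarrow> f (u \<star> x)"
proof -
  \<comment> \<open>First the test points are enlarged until they imitate all of \<open>X\<close>
    for the translates indexed by \<open>A\<close>; then \<open>s\<close> is chosen close to
    \<open>u\<close> on these finitely many points.\<close>
  have step: "\<exists>Y' s. finite Y' \<and> Y' \<subseteq> topspace X \<and> Y \<subseteq> Y' \<and> s \<in> T \<and>
      (\<forall>x\<in>topspace X. \<exists>y\<in>Y'. \<forall>a\<in>A. \<bar>f (a \<star> x) - f (a \<star> y)\<bar> < \<delta>) \<and>
      (\<forall>y\<in>Y'. \<bar>f (s \<star> y) - f (u \<star> y)\<bar> < \<delta>)"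
    if A: "finite A" "A \<subseteq> topspace X" and Y: "finite Y" "Y \<subseteq> topspace X" and "\<delta> > 0" for A Y and \<delta> :: real
  proof -
    obtain Z where Z: "finite Z" "Z \<subseteq> topspace X"
      "\<And>x. x \<in> topspace X \<Longrightarrow> \<exists>y\<in>Z. \<forall>h\<in>(\<lambda>a x. f (a \<star> x)) ` A. \<bar>h x - h y\<bar> < \<delta>"
    proof (rule compact_space_finite_net[OF compact, of "(\<lambda>a x. f (a \<star> x)) ` A" \<delta>])
      show "continuous_map X euclideanreal h" if "h \<in> (\<lambda>a x. f (a \<star> x)) ` A" for h
        using that A(2) by (auto intro: continuous_mul_left[OF f])
    qed (use A \<open>\<delta> > 0\<close> in auto)
    have YZ: "finite (Y \<union> Z)" "Y \<union> Z \<subseteq> topspace X" using Y Z by auto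
    have "openin X {s \<in> topspace X. \<bar>f (s \<star> y) - f (u \<star> y)\<bar> \<in> {..<\<delta>}}" if "y \<in> Y \<union> Z" for y
    proof (rule openin_continuous_map_preimage)
      have "y \<in> topspace X" using that YZ by blast
      then show "continuous_map X euclideanreal (\<lambda>s. \<bar>f (s \<star> y) - f (u \<star> y)\<bar>)"
        by (intro continuous_map_real_abs continuous_map_diff continuous_mul_right[OF f]
            continuous_map_const[THEN iffD2]) simp_all
    qed simp
    then have "openin X ((\<Inter>y\<in>Y \<union> Z. {s \<in> topspace X. \<bar>f (s \<star> y) - f (u \<star> y)\<bar> \<in> {..<\<delta>}}) \<inter> topspace X)"
      (is "openin X ?V") by (intro openin_INT YZ)
    moreover have "u \<in> ?V"
      using u \<open>\<delta> > 0\<close> by simp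
    ultimately have "T \<inter> ?V \<noteq> {}"
      by (intro T(2)[unfolded dense_intersects_open, THEN spec, THEN mp]) blast
    then obtain s where s: "s \<in> T" "s \<in> ?V" by (meson IntE all_not_in_conv)
    then have "\<forall>y\<in>Y \<union> Z. \<bar>f (s \<star> y) - f (u \<star> y)\<bar> < \<delta>" by simp
    note s = s(1) this
    have "\<forall>x\<in>topspace X. \<exists>y\<in>Y \<union> Z. \<forall>a\<in>A. \<bar>f (a \<star> x) - f (a \<star> y)\<bar> < \<delta>"
    proof
      fix x assume "x \<in> topspace X"
      then obtain y where "y \<in> Z" "\<forall>a\<in>A. \<bar>f (a \<star> x) - f (a \<star> y)\<bar> < \<delta>" using Z(3) by auto
      then show "\<exists>y\<in>Y \<union> Z. \<forall>a\<in>A. \<bar>f (a \<star> x) - f (a \<star> y)\<bar> < \<delta>" by blast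
    qed
    with s YZ show ?thesis by blast
  qed
  define P where "P = (\<lambda>(n::nat) (A, Y, s). finite A \<and> A \<subseteq> topspace X \<and> finite Y \<and> Y \<subseteq> topspace X \<and>
    s \<in> T \<and> s \<in> A \<and> u \<in> A)"
  define Q where "Q = (\<lambda>(n::nat) (A, Y, s :: 'b) (A', Y', s'). A \<subseteq> A' \<and> Y \<subseteq> Y' \<and>
    (\<forall>x\<in>topspace X. \<exists>y\<in>Y'. \<forall>a\<in>A. \<bar>f (a \<star> x) - f (a \<star> y)\<bar> < 1 / real (Suc n)) \<and>
    (\<forall>y\<in>Y'. \<bar>f (s' \<star> y) - f (u \<star> y)\<bar> < 1 / real (Suc n)))"
  obtain \<sigma> where \<sigma>: "\<And>n. P n (\<sigma> n)" "\<And>n. Q n (\<sigma> n) (\<sigma> (Suc n))"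
  proof (rule dependent_nat_choice[of P Q, THEN exE])
    have "T \<inter> topspace X \<noteq> {}" using T(2) dense_intersects_open[of X T] nonempty by blast
    then obtain s where "s \<in> T" by blast
    then have "P 0 ({s, u}, {}, s)" using T(1) u by (auto simp: P_def)
    then show "\<exists>x. P 0 x" ..
    fix \<tau> n assume "P n \<tau>"
    obtain A Y s where \<tau>: "\<tau> = (A, Y, s)" by (cases \<tau>)
    have *: "finite A" "A \<subseteq> topspace X" "finite Y" "Y \<subseteq> topspace X" "u \<in> A"
      using \<open>P n \<tau>\<close> by (simp_all add: P_def \<tau>)
    obtain Y' s' where "finite Y'" "Y' \<subseteq> topspace X" "Y \<subseteq> Y'" "s' \<in> T"
      "\<forall>x\<in>topspace X. \<exists>y\<in>Y'. \<forall>a\<in>A. \<bar>f (a \<star> x) - f (a \<star> y)\<bar> < 1 / real (Suc n)"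
      "\<forall>y\<in>Y'. \<bar>f (s' \<star> y) - f (u \<star> y)\<bar> < 1 / real (Suc n)"
      using step[OF *(1-4), of "1 / real (Suc n)"] by auto
    then have "P (Suc n) (insert s' A, Y', s')" "Q n \<tau> (insert s' A, Y', s')"
      using * T(1) by (auto simp: P_def Q_def \<tau>)
    then show "\<exists>\<tau>'. P (Suc n) \<tau>' \<and> Q n \<tau> \<tau>'" by blast
  qed blast
  define A Y s where "A n = fst (\<sigma> n)" and "Y n = fst (snd (\<sigma> n))" and "s n = snd (snd (\<sigma> n))" for n
  have \<sigma>_eq: "\<sigma> n = (A n, Y n, s n)" for n
    by (simp add: A_def Y_def s_def)
  have P: "s n \<in> T" "s n \<in> A n" "u \<in> A n" "Y n \<subseteq> topspace X" for n
    using \<sigma>(1)[of n] by (simp_all add: P_def \<sigma>_eq)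
  have Q: "A n \<subseteq> A (Suc n)" "Y n \<subseteq> Y (Suc n)"
    "x \<in> topspace X \<Longrightarrow> \<exists>y\<in>Y (Suc n). \<forall>a\<in>A n. \<bar>f (a \<star> x) - f (a \<star> y)\<bar> < 1 / real (Suc n)"
    "y \<in> Y (Suc n) \<Longrightarrow> \<bar>f (s (Suc n) \<star> y) - f (u \<star> y)\<bar> < 1 / real (Suc n)" for n x y
    using \<sigma>(2)[of n] by (simp_all add: Q_def \<sigma>_eq)
  have A_mono: "A k \<subseteq> A n" if "k \<le> n" for k n
    using that by (rule lift_Suc_mono_le[of A, OF Q(1)])
  have Y_mono: "Y k \<subseteq> Y n" if "k \<le> n" for k n
    using that by (rule lift_Suc_mono_le[of Y, OF Q(2)])
  have sX: "s n \<in> topspace X" for n using P(1) T(1) by blast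
  have inv_lim: "(\<lambda>n. 1 / real (Suc n)) \<longlonglongrightarrow> 0"
    using LIMSEQ_Suc[OF lim_1_over_n] .
  have "(\<lambda>n. f (s n \<star> x)) \<longlonglongrightarrow> f (u \<star> x)" if x: "x \<in> topspace X" for x
  proof (rule ccontr)
    assume "\<not> ?thesis"
    then obtain \<eta> where "\<eta> > 0" "\<not> (\<forall>\<^sub>F n in sequentially. \<bar>f (s n \<star> x) - f (u \<star> x)\<bar> < \<eta>)"
      unfolding tendsto_iff dist_real_def by blast
    then have "\<exists>\<^sub>\<infinity>n. \<eta> \<le> \<bar>f (s n \<star> x) - f (u \<star> x)\<bar>"
      by (simp add: not_eventually not_less cofinite_eq_sequentially)
    then have "infinite {n. \<eta> \<le> \<bar>f (s n \<star> x) - f (u \<star> x)\<bar>}"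
      by (simp add: frequently_cofinite)
    then obtain r :: "nat \<Rightarrow> nat" where r: "strict_mono r" "\<And>n. r n \<in> {n. \<eta> \<le> \<bar>f (s n \<star> x) - f (u \<star> x)\<bar>}"
      using infinite_enumerate by blast
    \<comment> \<open>Here \<open>z\<close> clusters along a subsequence that stays \<eta> away from
      the limit at \<open>x\<close>, and \<open>w\<close> below clusters along test points
      \<open>y n\<close> imitating \<open>x\<close>. The chain
      \<open>f (z x) = f (z w) = f (u w) = f (u x)\<close> then contradicts \<eta>.\<close>
    obtain z where z: "z \<in> topspace X"
      and zC: "\<And>C. closedin X C \<Longrightarrow> \<forall>\<^sub>F n in sequentially. s (r n) \<in> C \<Longrightarrow> z \<in> C"
      by (rule compact_space_sequence_cluster[OF compact sX[of "r _"]]) (rule that)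
    have "\<exists>y. y \<in> Y (Suc n) \<and> (\<forall>a\<in>A n. \<bar>f (a \<star> x) - f (a \<star> y)\<bar> < 1 / real (Suc n))" for n
      using Q(3)[OF x, of n] by blast
    then obtain y where y: "\<And>n. y n \<in> Y (Suc n)"
      "\<And>n a. a \<in> A n \<Longrightarrow> \<bar>f (a \<star> x) - f (a \<star> y n)\<bar> < 1 / real (Suc n)" by metis
    have yX: "y n \<in> topspace X" for n using y(1) P(4) by blast
    obtain w where w: "w \<in> topspace X"
      and wC: "\<And>C. closedin X C \<Longrightarrow> \<forall>\<^sub>F n in sequentially. y n \<in> C \<Longrightarrow> w \<in> C"
      by (rule compact_space_sequence_cluster[OF compact yX]) (rule that)
    have Aw: "f (a \<star> w) = f (a \<star> x)" if a: "a \<in> A k" "a \<in> topspace X" for a k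
    proof -
      have "\<bar>f (a \<star> w) - f (a \<star> x)\<bar> \<le> \<delta>" if "\<delta> > 0" for \<delta>
      proof -
        have "w \<in> {w \<in> topspace X. \<bar>f (a \<star> w) - f (a \<star> x)\<bar> \<le> \<delta>}"
        proof (rule wC)
          show "closedin X {w \<in> topspace X. \<bar>f (a \<star> w) - f (a \<star> x)\<bar> \<le> \<delta>}"
            by (intro closedin_le_preimage continuous_map_real_abs continuous_map_diff
                continuous_mul_left[OF f] a continuous_map_const[THEN iffD2]) simp_all
          have "\<forall>\<^sub>F n in sequentially. 1 / real (Suc n) < \<delta>"
            using order_tendstoD(2)[OF inv_lim that] .
          then show "\<forall>\<^sub>F n in sequentially. y n \<in> {w \<in> topspace X. \<bar>f (a \<star> w) - f (a \<star> x)\<bar> \<le> \<delta>}"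
            using eventually_ge_at_top[of k]
          proof eventually_elim
            case (elim n)
            then have "a \<in> A n" using A_mono a by blast
            from y(2)[OF this] elim(1) yX show ?case by (auto simp: abs_minus_commute)
          qed
        qed
        then show ?thesis by simp
      qed
      then show ?thesis using field_le_epsilon[of "\<bar>f (a \<star> w) - f (a \<star> x)\<bar>" 0] by simp
    qed
    \<comment> \<open>Each \<open>y n\<close> remains a test point from stage \<open>Suc n\<close>
      on, so the values of \<open>f (s m _)\<close> at it converge to that of
      \<open>f (u _)\<close>.\<close>
    have zy: "f (z \<star> y n) = f (u \<star> y n)" for n
    proof -
      have "\<bar>f (z \<star> y n) - f (u \<star> y n)\<bar> \<le> \<delta>" if "\<delta> > 0" for \<delta>
      proof -
        have "z \<in> {z \<in> topspace X. \<bar>f (z \<star> y n) - f (u \<star> y n)\<bar> \<le> \<delta>}"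
        proof (rule zC)
          show "closedin X {z \<in> topspace X. \<bar>f (z \<star> y n) - f (u \<star> y n)\<bar> \<le> \<delta>}"
            by (intro closedin_le_preimage continuous_map_real_abs continuous_map_diff
                continuous_mul_right[OF f] yX continuous_map_const[THEN iffD2]) simp_all
          have ev: "\<forall>\<^sub>F m in sequentially. \<bar>f (s (Suc m) \<star> y n) - f (u \<star> y n)\<bar> \<le> \<delta>"
            using order_tendstoD(2)[OF inv_lim that] eventually_ge_at_top[of n]
          proof eventually_elim
            case (elim m)
            then have "y n \<in> Y (Suc m)" using Y_mono[of "Suc n" "Suc m"] y(1) by auto
            from Q(4)[OF this] elim(1) show ?case by linarith
          qed
          have "\<forall>\<^sub>F m in sequentially. \<bar>f (s m \<star> y n) - f (u \<star> y n)\<bar> \<le> \<delta>"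
            by (rule eventually_sequentially_Suc[THEN iffD1, OF ev])
          from eventually_subseq[OF r(1) this]
          show "\<forall>\<^sub>F m in sequentially. s (r m) \<in> {z \<in> topspace X. \<bar>f (z \<star> y n) - f (u \<star> y n)\<bar> \<le> \<delta>}"
            by eventually_elim (simp add: sX)
        qed
        then show ?thesis by simp
      qed
      then show ?thesis using field_le_epsilon[of "\<bar>f (z \<star> y n) - f (u \<star> y n)\<bar>" 0] by simp
    qed
    have uX: "u \<in> topspace X" by fact
    have "w \<in> {w \<in> topspace X. \<bar>f (z \<star> w) - f (u \<star> w)\<bar> \<le> 0}"
      using zy yX by (intro wC closedin_le_preimage continuous_map_real_abs continuous_map_diff
          continuous_mul_left[OF f] z uX continuous_map_const[THEN iffD2]) simp_all
    then have 1: "f (z \<star> w) = f (u \<star> w)" by simp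
    have "z \<in> {z \<in> topspace X. \<bar>f (z \<star> w) - f (z \<star> x)\<bar> \<le> 0}"
      using Aw[OF P(2) sX] sX by (intro zC closedin_le_preimage continuous_map_real_abs continuous_map_diff
          continuous_mul_right[OF f] w x continuous_map_const[THEN iffD2]) simp_all
    then have 2: "f (z \<star> w) = f (z \<star> x)" by simp
    have 3: "f (u \<star> w) = f (u \<star> x)" by (rule Aw[OF P(3)[of 0] uX])
    have "z \<in> {z \<in> topspace X. \<eta> \<le> \<bar>f (z \<star> x) - f (u \<star> x)\<bar>}"
      using r(2) sX by (intro zC closedin_le_preimage continuous_map_real_abs continuous_map_diff
          continuous_mul_right[OF f] x continuous_map_const[THEN iffD2]) simp_all
    with 1 2 3 \<open>\<eta> > 0\<close> show False by simp
  qed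
  with P(1) show thesis by (rule that)
qed

text \<open>Each \<open>\<Lambda> (f (s n _))\<close> equals \<open>\<Lambda> f\<close>, and its
  distance to \<open>\<Lambda> (f (u _))\<close> is at most \<open>\<Lambda> (h n)\<close>. Since
  \<open>h n\<close> is bounded and tends to \<open>0\<close> pointwise, some
  \<open>\<Lambda> (h n)\<close> is smaller than the supposed gap.\<close>

lemma mean_invariant_closure:
  assumes "topological_mean X \<Lambda>" and T: "T \<subseteq> topspace X" "X closure_of T = topspace X"
    and inv: "\<And>s f. s \<in> T \<Longrightarrow> continuous_map X euclideanreal f \<Longrightarrow> \<Lambda> (\<lambda>x. f (s \<star> x)) = \<Lambda> f"
    and f: "continuous_map X euclideanreal f" and u: "u \<in> topspace X"
  shows "\<Lambda> (\<lambda>x. f (u \<star> x)) = \<Lambda> f"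
proof (rule ccontr)
  interpret topological_mean X \<Lambda> by fact
  assume neq: "\<Lambda> (\<lambda>x. f (u \<star> x)) \<noteq> \<Lambda> f"
  obtain s where s: "\<And>n :: nat. s n \<in> T"
    and lim: "\<And>x. x \<in> topspace X \<Longrightarrow> (\<lambda>n. f (s n \<star> x)) \<longlonglongrightarrow> f (u \<star> x)"
    by (rule sequential_approximation[OF T f u]) (rule that)
  have sX: "s n \<in> topspace X" for n using s T(1) by blast
  note cont = continuous_mul_left[OF f sX] continuous_mul_left[OF f u]
  define h where "h n x = \<bar>f (s n \<star> x) - f (u \<star> x)\<bar>" for n x
  have h: "continuous_map X euclideanreal (h n)" for n
    unfolding h_def by (intro continuous_map_real_abs continuous_map_diff cont)
  have "bounded (f ` topspace X)"
    using image_compactin[OF compact[unfolded compact_space_def] f] by (simp add: compact_imp_bounded)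
  then obtain B where B: "\<And>x. x \<in> topspace X \<Longrightarrow> \<bar>f x\<bar> \<le> B"
    unfolding bounded_iff by auto
  have "\<exists>n. \<Lambda> (h n) < \<bar>\<Lambda> f - \<Lambda> (\<lambda>x. f (u \<star> x))\<bar>"
  proof (rule pointwise_null_sequence[OF compact h])
    show "h n x \<le> 2 * B" if "x \<in> topspace X" for n x
      using B[of "s n \<star> x"] B[of "u \<star> x"] that sX u unfolding h_def by fastforce
    show "(\<lambda>n. h n x) \<longlonglongrightarrow> 0" if "x \<in> topspace X" for x
      unfolding h_def using lim[OF that] by (intro tendsto_rabs_zero) (simp add: LIM_zero_iff)
    show "0 < \<bar>\<Lambda> f - \<Lambda> (\<lambda>x. f (u \<star> x))\<bar>" using neq by simp
  qed
  then obtain n where n: "\<Lambda> (h n) < \<bar>\<Lambda> f - \<Lambda> (\<lambda>x. f (u \<star> x))\<bar>" ..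
  have "\<Lambda> (\<lambda>x. f (s n \<star> x) - f (u \<star> x)) \<le> \<Lambda> (h n)" "\<Lambda> (\<lambda>x. f (u \<star> x) - f (s n \<star> x)) \<le> \<Lambda> (h n)"
    by (intro mono h continuous_map_diff cont; simp add: h_def)+
  then show False
    using n inv[OF s f] by (simp add: diff[OF cont] diff[OF cont(2,1)])
qed

text \<open>The minimal right ideals \<open>p S\<close> and \<open>r S\<close> are equal or
  disjoint. If equal, \<open>r = p c\<close> gives \<open>p r = r\<close>, so \<open>p = r\<close>.
  If disjoint, a Urysohn function has the constant translates \<open>0\<close> and \<open>1\<close>,
  which must have the same mean.\<close>

lemma mean_left_equivalent_idempotents:
  assumes \<Lambda>: "topological_mean X \<Lambda>" and T: "T \<subseteq> topspace X" "X closure_of T = topspace X"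
    and inv: "\<And>s f. s \<in> T \<Longrightarrow> continuous_map X euclideanreal f \<Longrightarrow> \<Lambda> (\<lambda>x. f (s \<star> x)) = \<Lambda> f"
    and K: "least_ideal K" and p: "p \<in> K" and r: "r \<in> K"
    and pp: "p \<star> p = p" and rr: "r \<star> r = r" and pr: "p \<star> r = p"
  shows "p = r"
proof (rule ccontr)
  interpret topological_mean X \<Lambda> by fact
  assume "p \<noteq> r"
  note pX = least_ideal_closed(1)[OF K p] and rX = least_ideal_closed(1)[OF K r]
  let ?P = "(\<lambda>a. p \<star> a) ` topspace X" and ?R = "(\<lambda>a. r \<star> a) ` topspace X"
  have "disjnt ?P ?R"
  proof (rule ccontr)
    assume "\<not> ?thesis"
    then obtain w a b where w: "w = p \<star> a" "a \<in> topspace X" "w = r \<star> b" "b \<in> topspace X"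
      unfolding disjnt_def by blast
    have "?P = ?R"
      using least_ideal_right_eq[OF K p w(1,2)] least_ideal_right_eq[OF K r w(3,4)] by simp
    moreover have "r \<in> ?R" using rr rX by (metis imageI)
    ultimately obtain c where c: "r = p \<star> c" "c \<in> topspace X" by blast
    have "p \<star> r = r"
      using assoc[OF pX pX c(2)] unfolding c(1)[symmetric] pp by simp
    with pr \<open>p \<noteq> r\<close> show False by simp
  qed
  moreover have "closedin X ?P" "closedin X ?R"
    using pX rX by (intro closedin_image continuous_left; simp)+
  ultimately obtain f :: "'b \<Rightarrow> real" where f: "continuous_map X euclideanreal f"
    and "f ` ?P \<subseteq> {0}" "f ` ?R \<subseteq> {1}"
    using Urysohn_lemma_alt[OF normal] by metis
  then have f01: "f (p \<star> x) = 0" "f (r \<star> x) = 1" if "x \<in> topspace X" for x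
    using that by auto
  have invX: "\<Lambda> (\<lambda>x. f (u \<star> x)) = \<Lambda> f" if "u \<in> topspace X" for u
    using \<Lambda> T inv f that by (rule mean_invariant_closure)
  have "\<Lambda> (\<lambda>x. f (p \<star> x)) = \<Lambda> (\<lambda>x. 0)" "\<Lambda> (\<lambda>x. f (r \<star> x)) = \<Lambda> (\<lambda>x. 1)"
    using f01 by (intro antisym mono continuous_mul_left[OF f] pX rX; simp)+
  then show False using invX[OF pX] invX[OF rX] by (simp add: const)
qed

end

section \<open>Hahn-Banach\<close>

text \<open>One inequality encodes positive homogeneity, since it may be applied to
  \<open>inverse r\<close>; this leaves less to verify for infima.\<close>

definition sublinear :: "('a::real_vector \<Rightarrow> real) \<Rightarrow> bool"
  where "sublinear p \<longleftrightarrow>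
    (\<forall>x y. p (x + y) \<le> p x + p y) \<and> (\<forall>r>0. \<forall>x. p (r *\<^sub>R x) \<le> r * p x)"

lemma sublinear_add: "sublinear p \<Longrightarrow> p (x + y) \<le> p x + p y"
  by (simp add: sublinear_def)

lemma sublinear_scale:
  assumes "sublinear p" "r > 0"
  shows "p (r *\<^sub>R x) = r * p x"
proof (rule antisym)
  show "p (r *\<^sub>R x) \<le> r * p x" using assms by (simp add: sublinear_def)
  have "p (inverse r *\<^sub>R r *\<^sub>R x) \<le> inverse r * p (r *\<^sub>R x)"
    using assms unfolding sublinear_def by (metis positive_imp_inverse_positive)
  then show "r * p x \<le> p (r *\<^sub>R x)" using assms(2) by (simp add: field_simps)
qed

lemma sublinear_0: "sublinear p \<Longrightarrow> p 0 = 0"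
  using sublinear_scale[of p 2 0] by simp

lemma sublinear_minus: "sublinear p \<Longrightarrow> - p (- x) \<le> p x"
  using sublinear_add[of p x "- x"] sublinear_0[of p] by simp

text \<open>If \<open>p\<close> is minimal, then \<open>p' = p\<close> and hence \<open>p x + p y \<le> p (x + y)\<close>: minimal sublinear
  functionals are additive.\<close>

lemma sublinear_push:
  assumes p: "sublinear p"
  obtains p' where "sublinear p'" "\<And>x. p' x \<le> p x" "\<And>x. p' x \<le> p (x + y) - p y"
proof -
  \<comment> \<open>The parameters \<open>t = 0\<close> and \<open>t = 1\<close> give the two bounds
    required of the infimum \<open>p'\<close>.\<close>
  define F where "F x t = p (x + t *\<^sub>R y) - t * p y" for x t
  define p' where "p' x = (INF t\<in>{0..}. F x t)" for x
  have lower: "- p (- x) \<le> F x t" if "t \<ge> 0" for x t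
  proof -
    have "p (t *\<^sub>R y) = t * p y"
      using that sublinear_scale[OF p, of t y] sublinear_0[OF p] by (cases "t = 0") auto
    then show ?thesis
      using sublinear_add[OF p, of "x + t *\<^sub>R y" "- x"] by (simp add: F_def)
  qed
  have le: "p' x \<le> F x t" if "t \<ge> 0" for x t
    unfolding p'_def
  proof (rule cINF_lower)
    show "bdd_below (F x ` {0..})" using lower by (intro bdd_belowI2) auto
  qed (use that in simp)
  have greatest: "c \<le> p' x" if "\<And>t. t \<ge> 0 \<Longrightarrow> c \<le> F x t" for c x
    unfolding p'_def by (rule cINF_greatest) (use that in auto)
  have "sublinear p'"
    unfolding sublinear_def
  proof (intro conjI allI impI)
    fix x z
    have "p' (x + z) \<le> F x s + F z t" if "s \<ge> 0" "t \<ge> 0" for s t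
    proof -
      have "p' (x + z) \<le> F (x + z) (s + t)" using that by (intro le) simp
      also have "\<dots> \<le> F x s + F z t"
        using sublinear_add[OF p, of "x + s *\<^sub>R y" "z + t *\<^sub>R y"] by (simp add: F_def algebra_simps)
      finally show ?thesis .
    qed
    then have "p' (x + z) - F x s \<le> p' z" if "s \<ge> 0" for s
      using that by (intro greatest) (simp add: algebra_simps)
    then have "p' (x + z) - p' z \<le> p' x" by (intro greatest) (simp add: algebra_simps)
    then show "p' (x + z) \<le> p' x + p' z" by simp
  next
    fix r :: real and x assume "r > 0"
    have "p' (r *\<^sub>R x) / r \<le> F x t" if "t \<ge> 0" for t
    proof -
      have "F (r *\<^sub>R x) (r * t) = r * F x t"
        using sublinear_scale[OF p \<open>r > 0\<close>, of "x + t *\<^sub>R y"]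
        by (simp add: F_def algebra_simps)
      then have "p' (r *\<^sub>R x) \<le> r * F x t"
        using le[of "r * t" "r *\<^sub>R x"] that \<open>r > 0\<close> by simp
      then show ?thesis using \<open>r > 0\<close> by (simp add: field_simps)
    qed
    then have "p' (r *\<^sub>R x) / r \<le> p' x" by (rule greatest)
    then show "p' (r *\<^sub>R x) \<le> r * p' x" using \<open>r > 0\<close> by (simp add: field_simps)
  qed
  moreover have "p' x \<le> p x" "p' x \<le> p (x + y) - p y" for x
    using le[of 0 x] le[of 1 x] by (simp_all add: F_def)
  ultimately show thesis by (rule that)
qed

text \<open>Zorn's lemma for the reversed pointwise order, with chains bounded by their infimum. A
  minimal element is additive by \<open>sublinear_push\<close>, and with positive homogeneity it is
  linear.\<close>

lemma sublinear_minorant_linear: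
  assumes q: "sublinear q"
  obtains u where "linear u" "\<And>x. u x \<le> q x"
proof -
  let ?A = "{p. sublinear p \<and> (\<forall>x. p x \<le> q x)}"
  let ?P = "\<lambda>p p'. \<forall>x. p' x \<le> (p x :: real)"
  have "\<exists>m\<in>?A. \<forall>a\<in>?A. ?P m a \<longrightarrow> a = m"
  proof (rule predicate_Zorn)
    show "partial_order_on ?A (relation_of ?P ?A)"
      by (auto simp: partial_order_on_def preorder_on_def refl_on_def trans_def antisym_def
          relation_of_def fun_eq_iff intro: order_trans order_antisym)
    fix C assume C: "C \<in> Chains (relation_of ?P ?A)"
    have CA: "sublinear p" "p x \<le> q x" if "p \<in> C" for p x
      using C that by (auto simp: Chains_def relation_of_def)
    have lin: "(\<forall>x. p x \<le> p' x) \<or> (\<forall>x. p' x \<le> p x)" if "p \<in> C" "p' \<in> C" for p p'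
      using C that by (auto simp: Chains_def relation_of_def)
    show "\<exists>u\<in>?A. \<forall>a\<in>C. ?P a u"
    proof (cases "C = {}")
      case True
      then show ?thesis using q by blast
    next
      case False
      define u where "u x = (INF p\<in>C. p x)" for x
      have le: "u x \<le> p x" if "p \<in> C" for p x
        unfolding u_def
      proof (rule cINF_lower)
        have "- q (- x) \<le> p x" if "p \<in> C" for p
          using sublinear_minus[OF CA(1)[OF that], of x] CA(2)[OF that, of "- x"] by linarith
        then show "bdd_below ((\<lambda>p. p x) ` C)" by (intro bdd_belowI2) auto
      qed fact
      have greatest: "c \<le> u x" if "\<And>p. p \<in> C \<Longrightarrow> c \<le> p x" for c x
        unfolding u_def by (rule cINF_greatest[OF False that])
      have "sublinear u"
        unfolding sublinear_def
      proof (intro conjI allI impI)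
        fix x y
        \<comment> \<open>Of two members of the chain, the smaller one can be used at both
          \<open>x\<close> and \<open>y\<close>.\<close>
        have *: "u (x + y) \<le> p x + p' y" if "p \<in> C" "p' \<in> C" for p p'
        proof -
          have "u (x + y) \<le> p x + p y" "u (x + y) \<le> p' x + p' y"
            using le[OF that(1), of "x + y"] le[OF that(2), of "x + y"]
              sublinear_add[OF CA(1)[OF that(1)], of x y] sublinear_add[OF CA(1)[OF that(2)], of x y]
            by linarith+
          then show ?thesis using lin[OF that] by (metis add_left_mono add_right_mono order_trans)
        qed
        have "u (x + y) - p x \<le> u y" if "p \<in> C" for p
          using *[OF that] by (intro greatest) (simp add: algebra_simps)
        then have "u (x + y) - u y \<le> u x" by (intro greatest) (simp add: algebra_simps)
        then show "u (x + y) \<le> u x + u y" by simp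
      next
        fix r :: real and x assume "r > 0"
        have "u (r *\<^sub>R x) / r \<le> p x" if "p \<in> C" for p
          using le[OF that, of "r *\<^sub>R x"] sublinear_scale[OF CA(1)[OF that] \<open>r > 0\<close>, of x] \<open>r > 0\<close>
          by (simp add: field_simps)
        then have "u (r *\<^sub>R x) / r \<le> u x" by (rule greatest)
        then show "u (r *\<^sub>R x) \<le> r * u x" using \<open>r > 0\<close> by (simp add: field_simps)
      qed
      moreover obtain p where "p \<in> C" using False by blast
      then have "u x \<le> q x" for x using le CA(2) order_trans by blast
      ultimately show ?thesis using le by blast
    qed
  qed
  then obtain p where "p \<in> ?A" and min': "\<forall>a\<in>?A. ?P p a \<longrightarrow> a = p" by (rule bexE)
  then have p: "sublinear p" "p x \<le> q x" for x by simp_all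
  have min: "p' = p" if "sublinear p'" and le: "\<And>x. p' x \<le> p x" for p'
  proof -
    have "p' \<in> ?A" using that p(2) order_trans[OF le] by blast
    with min' le show ?thesis by simp
  qed
  have add: "p (x + y) = p x + p y" for x y
  proof -
    obtain p' where p': "sublinear p'" "\<And>x. p' x \<le> p x" "\<And>x. p' x \<le> p (x + y) - p y"
      by (rule sublinear_push[OF p(1)]) (rule that)
    have "p' = p" by (rule min[OF p'(1,2)])
    with p'(3)[of x] sublinear_add[OF p(1), of x y] show ?thesis by simp
  qed
  have neg: "p (- x) = - p x" for x
    using add[of x "- x"] sublinear_0[OF p(1)] by simp
  have scale: "p (r *\<^sub>R x) = r * p x" for r x
  proof (cases r "0 :: real" rule: linorder_cases)
    case less
    then show ?thesis using sublinear_scale[OF p(1), of "- r" x] neg[of "r *\<^sub>R x"] by simp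
  qed (simp_all add: sublinear_0[OF p(1)] sublinear_scale[OF p(1)])
  have "linear p" by (rule linearI) (simp_all add: add scale)
  then show thesis using p(2) by (rule that)
qed

text \<open>Pushing the norm in direction \<open>z\<close> gives
  \<open>p (- z) \<le> - norm z\<close>. A linear minorant of \<open>p\<close> then has value at
  least \<open>norm z\<close> at \<open>z\<close>.\<close>

lemma norming_functional:
  fixes z :: "'a::real_normed_vector"
  obtains u :: "'a \<Rightarrow> real" where "linear u" "\<And>x. \<bar>u x\<bar> \<le> norm x" "u z = norm z"
proof -
  have "sublinear (norm :: 'a \<Rightarrow> real)"
    by (simp add: sublinear_def norm_triangle_ineq)
  then obtain p where p: "sublinear p" "\<And>x. p x \<le> norm x" "\<And>x. p x \<le> norm (x + z) - norm z"
    by (rule sublinear_push[where y = z]) (rule that)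
  obtain u where u: "linear u" "\<And>x. u x \<le> p x"
    by (rule sublinear_minorant_linear[OF p(1)]) (rule that)
  have neg: "u (- x) = - u x" for x by (rule linear_neg[OF u(1)])
  have le: "u x \<le> norm x" for x using u(2)[of x] p(2)[of x] by linarith
  have "\<bar>u x\<bar> \<le> norm x" for x using le[of x] le[of "- x"] neg[of x] by simp
  moreover have "u z = norm z"
    using le[of z] u(2)[of "- z"] p(3)[of "- z"] neg[of z] by simp
  ultimately show thesis using u(1) by (intro that)
qed

text \<open>The real functional \<open>u\<close> is the real part of the complex functional
  \<open>u x - \<i> u (\<i> x)\<close>.\<close>

lemma bounded_clinear_functional_nonzero:
  fixes z :: "'a::complex_normed_vector"
  assumes "z \<noteq> 0"
  obtains \<phi> :: "'a \<Rightarrow> complex" where "bounded_clinear \<phi>" "\<phi> z \<noteq> 0"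
proof -
  obtain u :: "'a \<Rightarrow> real" where u: "linear u" "\<And>x. \<bar>u x\<bar> \<le> norm x" "u z = norm z"
    by (rule norming_functional[of z]) (rule that)
  define \<phi> where "\<phi> x = Complex (u x) (- u (\<i> *\<^sub>C x))" for x
  have scaleC: "c *\<^sub>C x = Re c *\<^sub>R x + Im c *\<^sub>R (\<i> *\<^sub>C x)" for c and x :: 'a
  proof -
    have "c = complex_of_real (Re c) + complex_of_real (Im c) * \<i>"
      by (simp add: complex_eq_iff)
    then have "c *\<^sub>C x = (complex_of_real (Re c) + complex_of_real (Im c) * \<i>) *\<^sub>C x" by simp
    then show ?thesis by (simp add: scaleC_add_left scaleR_scaleC scaleC_scaleC)
  qed
  have uC: "u (c *\<^sub>C x) = Re c * u x + Im c * u (\<i> *\<^sub>C x)" for c x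
    unfolding scaleC[of c x] by (simp add: linear_add[OF u(1)] linear_scale[OF u(1)])
  have hom: "\<phi> (c *\<^sub>C x) = c * \<phi> x" for c x
    using uC[of c x] uC[of "\<i> * c" x] by (simp add: \<phi>_def scaleC_scaleC complex_eq_iff)
  have "bounded_linear \<phi>"
  proof (rule bounded_linear_intro[where K = 2])
    show "\<phi> (x + y) = \<phi> x + \<phi> y" for x y
      by (simp add: \<phi>_def scaleC_add_right linear_add[OF u(1)] complex_eq_iff)
    show "\<phi> (r *\<^sub>R x) = r *\<^sub>R \<phi> x" for r x
      by (simp add: scaleR_scaleC hom scaleC_complex_def)
    show "norm (\<phi> x) \<le> norm x * 2" for x
      using cmod_le[of "\<phi> x"] u(2)[of x] u(2)[of "\<i> *\<^sub>C x"] by (simp add: \<phi>_def norm_scaleC)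
  qed
  then have "bounded_clinear \<phi>" using hom by (simp add: bounded_clinear_def scaleC_complex_def)
  moreover have "\<phi> z \<noteq> 0" using u(3) assms by (simp add: \<phi>_def complex_eq_iff)
  ultimately show thesis by (rule that)
qed

section \<open>The weak operator topology\<close>

lemma bounded_clinear_compose:
  "\<lbrakk>bounded_clinear f; bounded_clinear g\<rbrakk> \<Longrightarrow> bounded_clinear (\<lambda>x. f (g x))"
  by (simp add: bounded_clinear_def bounded_linear_compose)

lemma continuous_map_wot_eval:
  assumes "bounded_clinear (\<phi> :: 'a::complex_banach \<Rightarrow> complex)"
  shows "continuous_map wot euclidean (\<lambda>T. \<phi> (T x))"
  unfolding continuous_map_def
proof (intro conjI allI impI)
  fix U :: "complex set" assume "openin euclidean U"
  then have "openin wot {T. bounded_clinear T \<and> \<phi> (T x) \<in> U}"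
    unfolding wot_def using assms by (intro topology_generated_by_Basis) auto
  then show "openin wot {T \<in> topspace wot. \<phi> (T x) \<in> U}"
    by (simp add: topspace_wot)
qed simp

lemma continuous_map_into_wot:
  assumes "f ` topspace Y \<subseteq> topspace wot"
    and "\<And>(\<phi> :: 'a::complex_banach \<Rightarrow> complex) x. bounded_clinear \<phi> \<Longrightarrow> continuous_map Y euclidean (\<lambda>y. \<phi> (f y x))"
  shows "continuous_map Y wot f"
  unfolding wot_def
proof (rule continuous_on_generated_topo)
  show "f ` topspace Y \<subseteq> \<Union> {{T. bounded_clinear T \<and> \<phi> (T x) \<in> U} | (\<phi> :: 'a \<Rightarrow> complex) x U.
      bounded_clinear \<phi> \<and> open U}"
    using assms(1) unfolding wot_def topology_generated_by_topspace .
  fix V :: "('a \<Rightarrow> 'a) set"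
  assume "V \<in> {{T. bounded_clinear T \<and> \<phi> (T x) \<in> U} | (\<phi> :: 'a \<Rightarrow> complex) x U.
      bounded_clinear \<phi> \<and> open U}"
  then obtain \<phi> :: "'a \<Rightarrow> complex" and x U where
    V: "V = {T. bounded_clinear T \<and> \<phi> (T x) \<in> U}" "bounded_clinear \<phi>" "open U" by blast
  have "openin Y {y \<in> topspace Y. \<phi> (f y x) \<in> U}"
    using assms(2)[OF V(2)] V(3) by (intro openin_continuous_map_preimage) auto
  moreover have "f -` V \<inter> topspace Y = {y \<in> topspace Y. \<phi> (f y x) \<in> U}"
    using assms(1) by (auto simp: V(1) topspace_wot)
  ultimately show "openin Y (f -` V \<inter> topspace Y)" by simp
qed

lemma continuous_map_wot_compose_left:
  assumes V: "bounded_clinear V"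
  shows "continuous_map wot wot (\<lambda>T. V \<circ> T)"
proof (rule continuous_map_into_wot)
  show "(\<lambda>T. V \<circ> T) ` topspace wot \<subseteq> topspace wot"
    using V by (auto simp: topspace_wot o_def intro: bounded_clinear_compose)
  show "continuous_map wot euclidean (\<lambda>T. \<phi> ((V \<circ> T) x))"
    if "bounded_clinear \<phi>" for \<phi> :: "'a \<Rightarrow> complex" and x
    using continuous_map_wot_eval[OF bounded_clinear_compose[OF that V], of x] by simp
qed

lemma continuous_map_wot_compose_right:
  assumes V: "bounded_clinear V"
  shows "continuous_map wot wot (\<lambda>T. T \<circ> V)"
proof (rule continuous_map_into_wot)
  show "(\<lambda>T. T \<circ> V) ` topspace wot \<subseteq> topspace wot"
    using V by (auto simp: topspace_wot o_def intro: bounded_clinear_compose)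
  show "continuous_map wot euclidean (\<lambda>T. \<phi> ((T \<circ> V) x))"
    if "bounded_clinear \<phi>" for \<phi> :: "'a \<Rightarrow> complex" and x
    using continuous_map_wot_eval[OF that, of "V x"] by simp
qed

lemma Hausdorff_wot: "Hausdorff_space (wot :: ('a::complex_banach \<Rightarrow> 'a) topology)"
  unfolding Hausdorff_space_def
proof (intro allI impI)
  fix S T :: "'a \<Rightarrow> 'a" assume ST: "S \<in> topspace wot \<and> T \<in> topspace wot \<and> S \<noteq> T"
  then obtain x where "S x \<noteq> T x" by (auto simp: fun_eq_iff)
  then have "S x - T x \<noteq> 0" by simp
  then obtain \<phi> :: "'a \<Rightarrow> complex" where \<phi>: "bounded_clinear \<phi>" "\<phi> (S x - T x) \<noteq> 0"
    by (rule bounded_clinear_functional_nonzero)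
  have "linear \<phi>"
    using \<phi>(1) by (simp add: bounded_clinear_def bounded_linear.linear)
  with \<phi>(2) have "\<phi> (S x) \<noteq> \<phi> (T x)" by (simp add: linear_diff)
  then obtain U V where UV: "open U" "open V" "\<phi> (S x) \<in> U" "\<phi> (T x) \<in> V" "U \<inter> V = {}"
    by (meson hausdorff)
  let ?W = "\<lambda>U. {T \<in> topspace wot. \<phi> (T x) \<in> U}"
  have "openin wot (?W U)" "openin wot (?W V)"
    using UV by (auto intro!: openin_continuous_map_preimage[OF continuous_map_wot_eval[OF \<phi>(1)]])
  moreover have "S \<in> ?W U" "T \<in> ?W V" "disjnt (?W U) (?W V)"
    using ST UV by (auto simp: disjnt_def)
  ultimately show "\<exists>U V. openin wot U \<and> openin wot V \<and> S \<in> U \<and> T \<in> V \<and> disjnt U V" by blast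
qed

text \<open>Separate continuity requires two passages to the closure: first in the right factor with
  the left one in \<open>\<T>\<close>, then in the left factor with \<open>v\<close> fixed.\<close>

lemma operator_semigroup_closure:
  assumes T: "operator_semigroup \<T>" and u: "u \<in> wot closure_of \<T>" and v: "v \<in> wot closure_of \<T>"
  shows "u \<circ> v \<in> wot closure_of \<T>"
proof -
  have bc: "bounded_clinear w" if "w \<in> wot closure_of \<T>" for w
    using that closure_of_subset_topspace[of wot \<T>] by (auto simp: topspace_wot)
  have "s \<circ> v \<in> wot closure_of \<T>" if s: "s \<in> \<T>" for s
  proof -
    have "bounded_clinear s" using T s by (simp add: operator_semigroup_def)
    then have "(\<lambda>w. s \<circ> w) ` (wot closure_of \<T>) \<subseteq> wot closure_of ((\<lambda>w. s \<circ> w) ` \<T>)"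
      by (intro continuous_map_image_closure_subset continuous_map_wot_compose_left)
    also have "\<dots> \<subseteq> wot closure_of \<T>"
      using T s by (intro closure_of_mono) (auto simp: operator_semigroup_def)
    finally show ?thesis using v by blast
  qed
  then have "(\<lambda>s. s \<circ> v) ` \<T> \<subseteq> wot closure_of \<T>" by blast
  moreover have "(\<lambda>s. s \<circ> v) ` (wot closure_of \<T>) \<subseteq> wot closure_of ((\<lambda>s. s \<circ> v) ` \<T>)"
    using bc[OF v] by (intro continuous_map_image_closure_subset continuous_map_wot_compose_right)
  ultimately have "(\<lambda>s. s \<circ> v) ` (wot closure_of \<T>) \<subseteq> wot closure_of \<T>"
    by (meson closure_of_minimal closedin_closure_of order_trans)
  with u show ?thesis by blast
qed

lemma compact_semitop_semigroup_closure:
  assumes T: "operator_semigroup \<T>" "\<T> \<noteq> {}" and compact: "relatively_weakly_compact \<T>"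
  shows "compact_semitop_semigroup (subtopology wot (wot closure_of \<T>)) (\<circ>)"
proof
  let ?X = "subtopology wot (wot closure_of \<T>)"
  have top: "topspace ?X = wot closure_of \<T>"
    using closure_of_subset_topspace[of wot \<T>] by auto
  have bc: "bounded_clinear w" if "w \<in> topspace ?X" for w
    using that by (auto simp: topspace_wot)
  show "compact_space ?X"
    using compact by (simp add: relatively_weakly_compact_def compact_space_subtopology)
  show "Hausdorff_space ?X" by (rule Hausdorff_space_subtopology[OF Hausdorff_wot])
  have "\<T> \<subseteq> topspace wot" using T by (auto simp: operator_semigroup_def topspace_wot)
  then show "topspace ?X \<noteq> {}"
    using T(2) closure_of_subset[of \<T> wot] unfolding top by blast
  show "a \<circ> b \<circ> c = a \<circ> (b \<circ> c)" for a b c :: "'a \<Rightarrow> 'a" by (rule comp_assoc)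
  show "continuous_map ?X ?X (\<lambda>x. a \<circ> x)" if "a \<in> topspace ?X" for a
    unfolding continuous_map_in_subtopology
  proof
    show "continuous_map ?X wot (\<lambda>x. a \<circ> x)"
      by (intro continuous_map_from_subtopology continuous_map_wot_compose_left bc that)
    show "(\<lambda>x. a \<circ> x) \<in> topspace ?X \<rightarrow> wot closure_of \<T>"
      using that operator_semigroup_closure[OF T(1)] unfolding top by (intro Pi_I)
  qed
  show "continuous_map ?X ?X (\<lambda>x. x \<circ> a)" if "a \<in> topspace ?X" for a
    unfolding continuous_map_in_subtopology
  proof
    show "continuous_map ?X wot (\<lambda>x. x \<circ> a)"
      by (intro continuous_map_from_subtopology continuous_map_wot_compose_right bc that)
    show "(\<lambda>x. x \<circ> a) \<in> topspace ?X \<rightarrow> wot closure_of \<T>"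
      using that operator_semigroup_closure[OF T(1)] unfolding top by (intro Pi_I)
  qed
qed


section \<open>Representations\<close>

lemma Linf_continuous_bounded:
  fixes \<mu> :: "'s::topological_space measure" and k :: "'s \<Rightarrow> real"
  assumes "sets \<mu> = sets borel" "continuous_on UNIV k" "\<And>t. \<bar>k t\<bar> \<le> B"
  shows "(\<lambda>t. complex_of_real (k t)) \<in> Linf \<mu>"
proof -
  have "(\<lambda>t. complex_of_real (k t)) \<in> borel_measurable borel"
    using assms(2) by (intro borel_measurable_continuous_onI continuous_on_of_real)
  then have "(\<lambda>t. complex_of_real (k t)) \<in> borel_measurable \<mu>"
    using measurable_cong_sets[OF assms(1) refl, where N = borel] by blast
  moreover have "AE t in \<mu>. cmod (complex_of_real (k t)) \<le> B"
    using assms(3) by simp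
  ultimately show ?thesis unfolding Linf_def by blast
qed

lemma meanD:
  assumes "mean \<mu> m"
  shows mean_add: "\<lbrakk>f \<in> Linf \<mu>; g \<in> Linf \<mu>\<rbrakk> \<Longrightarrow> m (\<lambda>t. f t + g t) = m f + m g"
    and mean_scale: "f \<in> Linf \<mu> \<Longrightarrow> m (\<lambda>t. c * f t) = c * m f"
    and mean_nonneg: "\<lbrakk>f \<in> Linf \<mu>; AE t in \<mu>. f t \<in> \<real>\<^sub>\<ge>\<^sub>0\<rbrakk> \<Longrightarrow> m f \<in> \<real>\<^sub>\<ge>\<^sub>0"
    and mean_norm: "(SUP f \<in> {f \<in> Linf \<mu>. Linf_norm \<mu> f \<le> 1}. cmod (m f)) = 1"
  using assms unfolding mean_def by blast+

text \<open>The definition of a mean prescribes its norm, not its value at \<open>1\<close>. If that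
  value were \<open>0\<close>, positivity applied to \<open>B + k\<close> and \<open>B - k\<close>
  would annihilate every bounded real \<open>k\<close>, hence all of \<open>Linf\<close>, against
  norm \<open>1\<close>.\<close>

lemma mean_one_pos:
  assumes m: "mean \<mu> m"
  shows "Re (m (\<lambda>t. 1)) > 0"
proof (rule ccontr)
  assume neg: "\<not> ?thesis"
  note m_add = mean_add[OF m] and m_scale = mean_scale[OF m] and m_pos = mean_nonneg[OF m]
  have const: "(\<lambda>t. c) \<in> Linf \<mu>" for c
    by (auto simp: Linf_def)
  have "m (\<lambda>t. 1) \<in> \<real>\<^sub>\<ge>\<^sub>0" by (rule m_pos[OF const]) simp
  with neg have m1: "m (\<lambda>t. 1) = 0"
    by (auto simp: complex_nonneg_Reals_iff complex_eq_iff)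
  have m_const: "m (\<lambda>t. c) = 0" for c
    using m_scale[OF const[of 1], of c] m1 by simp
  have real: "m (\<lambda>t. complex_of_real (k t)) = 0"
    if k: "k \<in> borel_measurable \<mu>" and B: "AE t in \<mu>. \<bar>k t\<bar> \<le> B" for k B
  proof -
    have kL: "(\<lambda>t. complex_of_real (r * k t)) \<in> Linf \<mu>" for r
    proof -
      have "AE t in \<mu>. cmod (complex_of_real (r * k t)) \<le> \<bar>r\<bar> * B"
        using B by eventually_elim (simp add: norm_mult mult_left_mono)
      moreover have "(\<lambda>t. complex_of_real (r * k t)) \<in> borel_measurable \<mu>"
        using k by measurable
      ultimately show ?thesis unfolding Linf_def by blast
    qed
    have *: "m (\<lambda>t. complex_of_real (r * k t)) \<in> \<real>\<^sub>\<ge>\<^sub>0" if "\<bar>r\<bar> = 1" for r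
    proof -
      have sumL: "(\<lambda>t. complex_of_real B + complex_of_real (r * k t)) \<in> Linf \<mu>"
      proof -
        have "AE t in \<mu>. cmod (complex_of_real B + complex_of_real (r * k t)) \<le> \<bar>B\<bar> + \<bar>r\<bar> * B"
          using B
        proof eventually_elim
          case (elim t)
          have "cmod (complex_of_real B + complex_of_real (r * k t)) \<le> \<bar>B\<bar> + \<bar>r * k t\<bar>"
            using norm_triangle_ineq[of "complex_of_real B" "complex_of_real (r * k t)"]
            by (simp only: norm_of_real)
          with elim that show ?case by (simp add: abs_mult)
        qed
        moreover have "(\<lambda>t. complex_of_real B + complex_of_real (r * k t)) \<in> borel_measurable \<mu>"
          using k by measurable
        ultimately show ?thesis unfolding Linf_def by blast
      qed
      have "AE t in \<mu>. complex_of_real B + complex_of_real (r * k t) \<in> \<real>\<^sub>\<ge>\<^sub>0"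
        using B
      proof eventually_elim
        case (elim t)
        have "\<bar>r * k t\<bar> \<le> B" using elim that by (simp add: abs_mult)
        then have "0 \<le> B + r * k t" by linarith
        then show ?case by (simp add: complex_nonneg_Reals_iff)
      qed
      then have "m (\<lambda>t. complex_of_real B + complex_of_real (r * k t)) \<in> \<real>\<^sub>\<ge>\<^sub>0"
        by (rule m_pos[OF sumL])
      then show ?thesis using m_add[OF const kL[of r], of "complex_of_real B"] by (simp add: m_const)
    qed
    have "m (\<lambda>t. complex_of_real (- 1 * k t)) = - m (\<lambda>t. complex_of_real (k t))"
      using m_scale[OF kL[of 1], of "- 1"] by simp
    with *[of 1] *[of "- 1"] show ?thesis
      by (auto simp: complex_nonneg_Reals_iff complex_eq_iff)
  qed
  have zero: "m f = 0" if "f \<in> Linf \<mu>" for f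
  proof -
    obtain C where f: "f \<in> borel_measurable \<mu>" "AE t in \<mu>. cmod (f t) \<le> C"
      using \<open>f \<in> Linf \<mu>\<close> by (auto simp: Linf_def)
    have Re: "(\<lambda>t. Re (f t)) \<in> borel_measurable \<mu>" "AE t in \<mu>. \<bar>Re (f t)\<bar> \<le> C"
      and Im: "(\<lambda>t. Im (f t)) \<in> borel_measurable \<mu>" "AE t in \<mu>. \<bar>Im (f t)\<bar> \<le> C"
      using f(1) by (measurable, use f(2) in \<open>eventually_elim, use abs_Re_le_cmod abs_Im_le_cmod order_trans in blast\<close>)+
    have ReL: "(\<lambda>t. complex_of_real (Re (f t))) \<in> Linf \<mu>" and ImL: "(\<lambda>t. complex_of_real (Im (f t))) \<in> Linf \<mu>"
      using Re Im unfolding Linf_def by (auto intro!: exI[of _ C])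
    have ImL': "(\<lambda>t. \<i> * complex_of_real (Im (f t))) \<in> Linf \<mu>"
      using Im unfolding Linf_def by (auto intro!: exI[of _ C] simp: norm_mult)
    have "m (\<lambda>t. complex_of_real (Re (f t)) + \<i> * complex_of_real (Im (f t))) = 0"
      using m_add[OF ReL ImL'] m_scale[OF ImL, of \<i>] real[OF Re] real[OF Im] by simp
    then show ?thesis by (simp add: complex_eq[symmetric])
  qed
  have "Linf_norm \<mu> (\<lambda>t. 0) \<le> 1"
    unfolding Linf_norm_def
  proof (rule cInf_lower)
    show "bdd_below {C. 0 \<le> C \<and> (AE x in \<mu>. cmod 0 \<le> C)}"
      by (rule bdd_belowI[of _ 0]) simp
  qed simp
  \<comment> \<open>The set must be nonempty for the supremum of the zero values to be
    \<open>0\<close>.\<close>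
  then have "{f \<in> Linf \<mu>. Linf_norm \<mu> f \<le> 1} \<noteq> {}" using const[of 0] by blast
  then have "(SUP f \<in> {f \<in> Linf \<mu>. Linf_norm \<mu> f \<le> 1}. cmod (m f)) = 0"
    using zero by simp
  with mean_norm[OF m] show False by simp
qed

text \<open>The mean is pulled back along \<open>\<pi>\<close>; division by its positive value at
  \<open>1\<close> supplies the normalisation.\<close>

lemma topological_mean_of_mean:
  assumes sets: "sets \<mu> = sets (borel :: 's::topological_space measure)" and m: "mean \<mu> m"
    and X: "compact_space X" and \<pi>: "continuous_map euclidean X \<pi>"
  shows "topological_mean X
    (\<lambda>f. Re (m (\<lambda>t :: 's. complex_of_real (f (\<pi> t)))) / Re (m (\<lambda>t. 1)))"
    and "continuous_map X euclideanreal f \<Longrightarrow> (\<lambda>t. complex_of_real (f (\<pi> t))) \<in> Linf \<mu>"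
proof -
  have L: "(\<lambda>t. complex_of_real (f (\<pi> t))) \<in> Linf \<mu>" if f: "continuous_map X euclideanreal f" for f
  proof -
    have "bounded (f ` topspace X)"
      using image_compactin[OF X[unfolded compact_space_def] f] by (simp add: compact_imp_bounded)
    then obtain B where B: "\<And>x. x \<in> topspace X \<Longrightarrow> \<bar>f x\<bar> \<le> B"
      unfolding bounded_iff by auto
    have "\<pi> t \<in> topspace X" for t
      using continuous_map_image_subset_topspace[OF \<pi>] by auto
    moreover have "continuous_on UNIV (\<lambda>t. f (\<pi> t))"
      using continuous_map_compose[OF \<pi> f] by (simp add: o_def)
    ultimately show ?thesis using B by (intro Linf_continuous_bounded[OF sets, of _ B]) auto
  qed
  then show "continuous_map X euclideanreal f \<Longrightarrow> (\<lambda>t. complex_of_real (f (\<pi> t))) \<in> Linf \<mu>" .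
  have m1: "Re (m (\<lambda>t. 1)) > 0" by (rule mean_one_pos[OF m])
  let ?M = "\<lambda>f. m (\<lambda>t. complex_of_real (f (\<pi> t)))"
  have add: "?M (\<lambda>x. f x + g x) = ?M f + ?M g"
    if "continuous_map X euclideanreal f" "continuous_map X euclideanreal g" for f g
    using mean_add[OF m L[OF that(1)] L[OF that(2)]] by simp
  show "topological_mean X (\<lambda>f. Re (?M f) / Re (m (\<lambda>t. 1)))"
  proof
    fix f g assume f: "continuous_map X euclideanreal f" and g: "continuous_map X euclideanreal g"
    show "Re (?M (\<lambda>x. f x + g x)) / Re (m (\<lambda>t. 1)) = Re (?M f) / Re (m (\<lambda>t. 1)) + Re (?M g) / Re (m (\<lambda>t. 1))"
      using add[OF f g] by (simp add: add_divide_distrib)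
    assume le: "\<And>x. x \<in> topspace X \<Longrightarrow> f x \<le> g x"
    have gf: "continuous_map X euclideanreal (\<lambda>x. g x - f x)"
      using g f by (rule continuous_map_diff)
    have "\<pi> t \<in> topspace X" for t
      using continuous_map_image_subset_topspace[OF \<pi>] by auto
    then have "AE t in \<mu>. complex_of_real (g (\<pi> t) - f (\<pi> t)) \<in> \<real>\<^sub>\<ge>\<^sub>0"
      using le by (simp add: complex_nonneg_Reals_iff)
    then have "?M (\<lambda>x. g x - f x) \<in> \<real>\<^sub>\<ge>\<^sub>0"
      by (rule mean_nonneg[OF m L[OF gf]])
    moreover have "?M g = ?M f + ?M (\<lambda>x. g x - f x)"
      using add[OF f gf] by simp
    ultimately show "Re (?M f) / Re (m (\<lambda>t. 1)) \<le> Re (?M g) / Re (m (\<lambda>t. 1))"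
      using m1 by (intro divide_right_mono) (auto simp: complex_nonneg_Reals_iff)
  next
    fix c :: real
    have "(\<lambda>t. 1) \<in> Linf \<mu>" by (auto simp: Linf_def)
    from mean_scale[OF m this, of "complex_of_real c"]
    have "m (\<lambda>t. complex_of_real c * 1) = complex_of_real c * m (\<lambda>t. 1)" .
    then show "Re (?M (\<lambda>x. c)) / Re (m (\<lambda>t. 1)) = c" using m1 by simp
  qed
qed

section \<open>The closure of the image of a representation\<close>

lemma unique_minimal_idempotent_range:
  fixes \<pi> :: "'s::{semigroup_mult,topological_space} \<Rightarrow> 'a::complex_banach \<Rightarrow> 'a"
  assumes S: "topological_group TYPE('s) \<or> (\<exists>\<mu> :: 's measure. bi_amenable \<mu>)"
    and rep: "semigroup_rep \<pi>" and compact: "relatively_weakly_compact (range \<pi>)"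
  shows "operator_semigroup (range \<pi>)" "\<exists>!p. minimal_idempotent (wot closure_of range \<pi>) p"
proof -
  have hom: "\<pi> (s * t) = \<pi> s \<circ> \<pi> t" and cont: "continuous_map euclidean wot \<pi>" for s t
    using rep by (simp_all add: semigroup_rep_def)
  have bc: "range \<pi> \<subseteq> topspace wot"
    using continuous_map_image_subset_topspace[OF cont] by simp
  show sg: "operator_semigroup (range \<pi>)"
    unfolding operator_semigroup_def
  proof (intro conjI ballI)
    show "bounded_clinear u" if "u \<in> range \<pi>" for u
      using bc that by (auto simp: topspace_wot)
    show "u \<circ> v \<in> range \<pi>" if "u \<in> range \<pi>" "v \<in> range \<pi>" for u v
      using that by (auto simp flip: hom)
  qed
  let ?S = "wot closure_of range \<pi>"
  let ?X = "subtopology wot ?S"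
  have top: "topspace ?X = ?S"
    using closure_of_subset_topspace[of wot "range \<pi>"] by auto
  interpret compact_semitop_semigroup ?X "(\<circ>)"
    using sg compact by (intro compact_semitop_semigroup_closure) auto
  have sub: "range \<pi> \<subseteq> topspace ?X"
    unfolding top using bc by (rule closure_of_subset)
  have \<pi>X: "\<pi> s \<in> topspace ?X" for s using sub by blast
  have dense: "?X closure_of range \<pi> = topspace ?X"
    using sub unfolding top by (simp add: closure_of_subtopology Int_absorb1)
  have cont': "continuous_map euclidean ?X \<pi>"
    using cont sub unfolding top by (auto simp: continuous_map_in_subtopology)
  obtain K where K: "least_ideal K" using least_ideal_exists by blast
  have Kop: "compact_semitop_semigroup.least_ideal ?X (\<lambda>x y. y \<circ> x) K"
    using K by (simp add: opposite_least_ideal)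
  \<comment> \<open>These are the two hypotheses of \<open>least_ideal_unique_idempotent\<close>. In
    both cases the second conjunct comes from the opposite semigroup.\<close>
  have equiv: "(\<forall>p\<in>K. \<forall>r\<in>K. p \<circ> p = p \<longrightarrow> r \<circ> r = r \<longrightarrow> p \<circ> r = p \<longrightarrow> r \<circ> p = r \<longrightarrow> p = r) \<and>
    (\<forall>p\<in>K. \<forall>r\<in>K. p \<circ> p = p \<longrightarrow> r \<circ> r = r \<longrightarrow> p \<circ> r = r \<longrightarrow> r \<circ> p = p \<longrightarrow> p = r)"
    using S
  proof
    assume "topological_group TYPE('s)"
    then obtain e :: 's and i where "group (*) e i" by (auto simp: topological_group_def)
    then interpret G: group "(*)" e i .
    \<comment> \<open>The unit clause of \<open>semigroup_rep\<close> makes the operators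
      \<open>\<pi> s\<close> invertible, with inverses again in the image.\<close>
    have "\<pi> e = id"
      using rep G.left_neutral G.right_neutral unfolding semigroup_rep_def by blast
    then have inv: "\<pi> (i s) \<circ> \<pi> s = id" "\<pi> s \<circ> \<pi> (i s) = id" for s
      by (simp_all flip: hom)
    have mul: "u \<circ> v \<in> range \<pi>" if "u \<in> range \<pi>" "v \<in> range \<pi>" for u v
      using that by (auto simp flip: hom)
    have inv_left: "\<exists>y\<in>topspace ?X. \<forall>x\<in>topspace ?X. y \<circ> (g \<circ> x) = x" if g: "g \<in> range \<pi>" for g
    proof -
      from g obtain s where "g = \<pi> s" by (rule rangeE)
      then have "\<pi> (i s) \<circ> (g \<circ> x) = x" for x
        by (simp add: inv flip: comp_assoc)
      then show ?thesis using \<pi>X by blast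
    qed
    have inv_right: "\<exists>y\<in>topspace ?X. \<forall>x\<in>topspace ?X. (x \<circ> g) \<circ> y = x" if g: "g \<in> range \<pi>" for g
    proof -
      from g obtain s where "g = \<pi> s" by (rule rangeE)
      then have "(x \<circ> g) \<circ> \<pi> (i s) = x" for x
        by (simp add: inv comp_assoc)
      then show ?thesis using \<pi>X by blast
    qed
    show ?thesis
    proof (intro conjI ballI impI)
      fix p r assume p: "p \<in> K" and r: "r \<in> K" and eq: "p \<circ> p = p" "p \<circ> r = p" "r \<circ> p = r"
      from sub dense mul inv_left least_ideal_closed(1)[OF K p] least_ideal_closed(1)[OF K r] eq
      show "p = r" by (rule dense_group_left_equivalent_idempotents)
    next
      fix p r assume p: "p \<in> K" and r: "r \<in> K" and eq: "p \<circ> p = p" "r \<circ> p = p" "p \<circ> r = r"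
      from sub dense mul inv_right least_ideal_closed(1)[OF K p] least_ideal_closed(1)[OF K r] eq
      show "p = r"
        by (rule compact_semitop_semigroup.dense_group_left_equivalent_idempotents[OF opposite])
    qed
  next
    assume "\<exists>\<mu> :: 's measure. bi_amenable \<mu>"
    then obtain \<mu> :: "'s measure" and m where sets: "sets \<mu> = sets borel"
      and m: "mean \<mu> m" "bi_invariant \<mu> m"
      by (auto simp: bi_amenable_def measured_semigroup_def)
    let ?\<Lambda> = "\<lambda>f. Re (m (\<lambda>t. complex_of_real (f (\<pi> t)))) / Re (m (\<lambda>t. 1))"
    note mean = topological_mean_of_mean[OF sets m(1) local.compact cont']
    have inv: "m (\<lambda>t. complex_of_real (f (\<pi> (s * t)))) = m (\<lambda>t. complex_of_real (f (\<pi> t)))"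
      "m (\<lambda>t. complex_of_real (f (\<pi> (t * s)))) = m (\<lambda>t. complex_of_real (f (\<pi> t)))"
      if "continuous_map ?X euclideanreal f" for f s
      using m(2)[unfolded bi_invariant_def, THEN spec, THEN bspec, OF mean(2)[OF that], of s] by simp_all
    have inv_left: "?\<Lambda> (\<lambda>x. f (g \<circ> x)) = ?\<Lambda> f"
      if g: "g \<in> range \<pi>" and f: "continuous_map ?X euclideanreal f" for g f
    proof -
      from g obtain s where "g = \<pi> s" by (rule rangeE)
      then show ?thesis using inv(1)[OF f, of s] by (simp add: hom)
    qed
    have inv_right: "?\<Lambda> (\<lambda>x. f (x \<circ> g)) = ?\<Lambda> f"
      if g: "g \<in> range \<pi>" and f: "continuous_map ?X euclideanreal f" for g f
    proof -
      from g obtain s where "g = \<pi> s" by (rule rangeE)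
      then show ?thesis using inv(2)[OF f, of s] by (simp add: hom)
    qed
    show ?thesis
    proof (intro conjI ballI impI)
      fix p r assume "p \<in> K" "r \<in> K" "p \<circ> p = p" "r \<circ> r = r" "p \<circ> r = p"
      with mean(1) sub dense inv_left K show "p = r" by (rule mean_left_equivalent_idempotents)
    next
      fix p r assume "p \<in> K" "r \<in> K" "p \<circ> p = p" "r \<circ> r = r" "r \<circ> p = p"
      with mean(1) sub dense inv_right Kop show "p = r"
        by (rule compact_semitop_semigroup.mean_left_equivalent_idempotents[OF opposite])
    qed
  qed
  have "\<exists>!p. p \<in> K \<and> p \<circ> p = p"
    by (rule least_ideal_unique_idempotent[OF K])
      (rule equiv[THEN conjunct1, rule_format] equiv[THEN conjunct2, rule_format]; assumption)+
  \<comment> \<open>The definition quantifies over a smallest ideal; two such ideals contain each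
    other, so it is always \<open>K\<close>.\<close>
  moreover have "minimal_idempotent ?S p \<longleftrightarrow> p \<in> K \<and> p \<circ> p = p" for p
  proof -
    have "two_sided_ideal I ?S \<longleftrightarrow> ideal I" for I
      unfolding two_sided_ideal_def ideal_def top ..
    then have "smallest_ideal K' ?S \<longleftrightarrow> least_ideal K'" for K'
      unfolding smallest_ideal_def least_ideal_def by simp
    moreover have "K' = K" if "least_ideal K'" for K'
      using that K unfolding least_ideal_def by blast
    ultimately show ?thesis
      using K least_ideal_closed(1)[OF K] unfolding minimal_idempotent_def top by metis
  qed
  ultimately show "\<exists>!p. minimal_idempotent ?S p" by simp
qed

text \<open>Apart from the semigroup property, \<open>JdLG_admissible\<close> depends on a set of
  operators only through its closure.\<close>

theorem corollary1p4:
  fixes \<pi> :: "'s::{semigroup_mult,topological_space} \<Rightarrow> 'a::complex_banach \<Rightarrow> 'a"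
  assumes "topological_group TYPE('s) \<or> (\<exists>\<mu> :: 's measure. bi_amenable \<mu>)"
    and "semigroup_rep \<pi>"
    and "relatively_weakly_compact (range \<pi>)"
  shows "JdLG_admissible (range \<pi>) \<and>
    (\<forall>\<T>. operator_semigroup \<T> \<and> wot closure_of \<T> = wot closure_of (range \<pi>) \<longrightarrow>
      JdLG_admissible \<T>)"
  using unique_minimal_idempotent_range[OF assms] assms(3)
  by (simp add: JdLG_admissible_def relatively_weakly_compact_def)

end
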